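(* For $k\in\{1,2\}$, the problem $k$-Edge Contraction($\gamma$) is polynomial-time solvable on $P_5$-free graphs.
   Context: All graphs are finite, undirected, simple and connected. $P_5$ is the path on 5 vertices; a graph is $P_5$-free if it has no induced subgraph isomorphic to $P_5$. The domination number $\gamma(G)$ is the minimum size of a set $D\subseteq V(G)$ such that every vertex outside $D$ has a neighbor in $D$. The contraction of an edge $uv$ removes $u$ and $v$ and replaces them by a new vertex adjacent to exactly those vertices that were adjacent to $u$ or $v$ (no loops or multiple edges are created). For a fixed integer $k\geq 1$, the problem $k$-Edge Contraction($\gamma$) is: given a connected graph $G$, decide whether $G$ can be transformed by a sequence of at most $k$ edge contractions into a graph $G'$ with $\gamma(G')\leq\gamma(G)-1$. *)

theory Defs
  imports "HOL-Computational_Algebra.Polynomial"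
begin

section \<open>Graphs\<close>

record 'a graph =
  verts :: "'a set"
  edges :: "'a set set"

definition simple_graph :: "'a graph \<Rightarrow> bool" where
  "simple_graph G \<longleftrightarrow>
     finite (verts G) \<and> edges G \<subseteq> {{u, v} | u v. u \<in> verts G \<and> v \<in> verts G \<and> u \<noteq> v}"

definition adjacent :: "'a graph \<Rightarrow> 'a \<Rightarrow> 'a \<Rightarrow> bool" where
  "adjacent G u v \<longleftrightarrow> {u, v} \<in> edges G"

text \<open>Connected graphs are nonempty by convention.\<close>

definition connected_graph :: "'a graph \<Rightarrow> bool" where
  "connected_graph G \<longleftrightarrow>
     verts G \<noteq> {} \<and> (\<forall>u\<in>verts G. \<forall>v\<in>verts G. (adjacent G)\<^sup>*\<^sup>* u v)"

definition induced_subgraph :: "'a graph \<Rightarrow> 'a set \<Rightarrow> 'a graph" where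
  "induced_subgraph G S = \<lparr>verts = S, edges = {e \<in> edges G. e \<subseteq> S}\<rparr>"

definition isomorphic :: "'a graph \<Rightarrow> 'b graph \<Rightarrow> bool" where
  "isomorphic G H \<longleftrightarrow>
     (\<exists>f. bij_betw f (verts G) (verts H) \<and>
          (\<forall>u\<in>verts G. \<forall>v\<in>verts G. adjacent G u v \<longleftrightarrow> adjacent H (f u) (f v)))"

definition induced_free :: "'b graph \<Rightarrow> 'a graph \<Rightarrow> bool" where
  "induced_free H G \<longleftrightarrow> \<not> (\<exists>S\<subseteq>verts G. isomorphic (induced_subgraph G S) H)"

definition path_graph :: "nat \<Rightarrow> nat graph" where
  "path_graph n = \<lparr>verts = {..<n}, edges = {{i, Suc i} | i. Suc i < n}\<rparr>"

definition dominating_set :: "'a graph \<Rightarrow> 'a set \<Rightarrow> bool" where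
  "dominating_set G D \<longleftrightarrow>
     D \<subseteq> verts G \<and> (\<forall>v\<in>verts G - D. \<exists>u\<in>D. adjacent G v u)"

definition domination_number :: "'a graph \<Rightarrow> nat" where
  "domination_number G = (LEAST n. \<exists>D. dominating_set G D \<and> card D = n)"


section \<open>Edge contraction\<close>

definition contract_edge :: "'a graph \<Rightarrow> 'a \<Rightarrow> 'a \<Rightarrow> 'a \<Rightarrow> 'a graph" where
  "contract_edge G u v w =
     \<lparr>verts = insert w (verts G - {u, v}),
      edges = {e \<in> edges G. u \<notin> e \<and> v \<notin> e} \<union>
              {{w, x} | x. x \<in> verts G - {u, v} \<and> (adjacent G x u \<or> adjacent G x v)}\<rparr>"

text \<open>The new vertex \<open>w\<close> is an arbitrary fresh element of the vertex type; one always
  exists for finite graphs over an infinite type such as \<^typ>\<open>nat\<close>.\<close>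

definition contracts_to :: "'a graph \<Rightarrow> 'a graph \<Rightarrow> bool" where
  "contracts_to G G' \<longleftrightarrow>
     (\<exists>u v w. adjacent G u v \<and> w \<notin> verts G \<and> G' = contract_edge G u v w)"

text \<open>The yes-instances; \<open>\<gamma>(G') \<le> \<gamma>(G) - 1\<close> is stated without truncating subtraction.\<close>

definition edge_contraction_gamma :: "nat \<Rightarrow> 'a graph \<Rightarrow> bool" where
  "edge_contraction_gamma k G \<longleftrightarrow>
     (\<exists>i\<le>k. \<exists>G'. (contracts_to ^^ i) G G' \<and>
                domination_number G' + 1 \<le> domination_number G)"


section \<open>Deterministic multitape Turing machines\<close>

text \<open>
  Control states are \<open>0, \<dots>, num_states - 1\<close>, with \<open>0\<close> initial, \<open>1\<close> accepting and \<open>2\<close>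
  rejecting. Tape symbols are \<open>0, \<dots>, num_symbols - 1\<close>, with \<open>0\<close> the blank and \<open>1\<close>, \<open>2\<close>
  the input bits. The transition function receives the current state and the list of scanned
  symbols, one per tape, and yields the next state and one (symbol to write, head move) per
  tape. Only its finitely many values on in-range arguments are ever used.
\<close>

datatype head_move = Move_Left | Stay | Move_Right

record tm =
  num_tapes :: nat
  num_states :: nat
  num_symbols :: nat
  trans :: "nat \<Rightarrow> nat list \<Rightarrow> nat \<times> (nat \<times> head_move) list"

definition wf_tm :: "tm \<Rightarrow> bool" where
  "wf_tm M \<longleftrightarrow>
     num_tapes M \<ge> 1 \<and> num_states M \<ge> 3 \<and> num_symbols M \<ge> 3 \<and>
     (\<forall>q xs. q < num_states M \<and> length xs = num_tapes M \<and> set xs \<subseteq> {..<num_symbols M} \<longrightarrow>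
        fst (trans M q xs) < num_states M \<and>
        length (snd (trans M q xs)) = num_tapes M \<and>
        fst ` set (snd (trans M q xs)) \<subseteq> {..<num_symbols M})"

abbreviation (input) "init_state \<equiv> 0 :: nat"
abbreviation (input) "accept_state \<equiv> 1 :: nat"
abbreviation (input) "reject_state \<equiv> 2 :: nat"

text \<open>A tape is two-way infinite and comes with its head position.\<close>

type_synonym tape = "(int \<Rightarrow> nat) \<times> int"
type_synonym config = "nat \<times> tape list"

fun scanned :: "tape \<Rightarrow> nat" where
  "scanned (c, p) = c p"

fun move_head :: "head_move \<Rightarrow> int \<Rightarrow> int" where
  "move_head Move_Left p = p - 1"
| "move_head Stay p = p"
| "move_head Move_Right p = p + 1"

fun act :: "nat \<times> head_move \<Rightarrow> tape \<Rightarrow> tape" where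
  "act (s, m) (c, p) = (c(p := s), move_head m p)"

fun tm_step :: "tm \<Rightarrow> config \<Rightarrow> config" where
  "tm_step M (q, ts) =
     (if q = accept_state \<or> q = reject_state then (q, ts)
      else (case trans M q (map scanned ts) of (q', as) \<Rightarrow> (q', map2 act as ts)))"

definition blank_tape :: tape where
  "blank_tape = (\<lambda>_. 0, 0)"

definition input_tape :: "bool list \<Rightarrow> tape" where
  "input_tape x =
     (\<lambda>i. if 0 \<le> i \<and> i < int (length x) then (if x ! nat i then 2 else 1) else 0, 0)"

definition init_config :: "tm \<Rightarrow> bool list \<Rightarrow> config" where
  "init_config M x = (init_state, input_tape x # replicate (num_tapes M - 1) blank_tape)"

definition accepts_within :: "tm \<Rightarrow> bool list \<Rightarrow> nat \<Rightarrow> bool" where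
  "accepts_within M x T \<longleftrightarrow> (\<exists>t\<le>T. fst ((tm_step M ^^ t) (init_config M x)) = accept_state)"

definition rejects_within :: "tm \<Rightarrow> bool list \<Rightarrow> nat \<Rightarrow> bool" where
  "rejects_within M x T \<longleftrightarrow> (\<exists>t\<le>T. fst ((tm_step M ^^ t) (init_config M x)) = reject_state)"


section \<open>Graph problems solvable in polynomial time\<close>

text \<open>A graph with vertex set \<open>{0, \<dots>, n - 1}\<close> is encoded by \<open>n\<close> in unary, a separator, and
  its adjacency matrix in row-major order.\<close>

definition encode_graph :: "nat graph \<Rightarrow> bool list" where
  "encode_graph G =
     (let n = card (verts G)
      in replicate n True @ False # concat (map (\<lambda>i. map (adjacent G i) [0..<n]) [0..<n]))"

text \<open>\<open>C\<close> is the class of graphs to which the instances are restricted, \<open>P\<close> the set of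
  yes-instances. Nothing is required of the machine on strings that do not encode a graph
  in \<open>C\<close>.\<close>

definition poly_time_solvable_on :: "(nat graph \<Rightarrow> bool) \<Rightarrow> (nat graph \<Rightarrow> bool) \<Rightarrow> bool" where
  "poly_time_solvable_on C P \<longleftrightarrow>
     (\<exists>M. \<exists>p :: nat poly. wf_tm M \<and>
        (\<forall>G. simple_graph G \<and> (\<exists>n. verts G = {..<n}) \<and> C G \<longrightarrow>
           (let x = encode_graph G; T = poly p (length x)
            in if P G then accepts_within M x T else rejects_within M x T)))"

end

theory Submission
  imports Defs
begin

text \<open>
  Let \<open>G\<close> be a connected \<open>P\<^sub>5\<close>-free graph. If \<open>\<gamma>(G) \<ge> 3\<close>, then some minimum dominating set contains
  an edge: otherwise take a minimum dominating set \<open>D\<close> and replace a few of its vertices by the same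
  number of others that span an edge; each such replacement must leave a vertex undominated, and
  suitable replacements yield an induced \<open>P\<^sub>5\<close>. Contracting that edge lowers \<open>\<gamma>\<close>. If \<open>\<gamma>(G) = 2\<close>, the
  same argument gives a minimum dominating set with an edge or with a common neighbour of its two
  vertices, so that two contractions always suffice, while one suffices iff \<open>G\<close> has a dominating
  edge. If \<open>\<gamma>(G) = 1\<close>, no contraction helps. Hence for \<open>k = 2\<close> the answer is yes iff there is no
  universal vertex, and for \<open>k = 1\<close> iff in addition there is a dominating edge or no dominating
  pair at all.

  Both criteria depend only on which combinations of the bits \<open>A u j\<close>, \<open>A v j\<close>, \<open>j = u\<close>, \<open>j = v\<close>
  occur, as \<open>j\<close> varies, for the pairs \<open>(u, v)\<close>. There are boundedly many sets of sets of such
  combinations, so a machine can collect this information in its finite control.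
\<close>

section \<open>Dominating sets in \<open>P\<^sub>5\<close>-free graphs\<close>

lemma adjacent_commute: "adjacent G u v \<longleftrightarrow> adjacent G v u"
  by (simp add: adjacent_def insert_commute)

lemma adjacent_in_verts:
  assumes "simple_graph G" "adjacent G u v"
  shows "u \<in> verts G" "v \<in> verts G" "u \<noteq> v"
  using assms unfolding simple_graph_def adjacent_def by (fastforce simp: doubleton_eq_iff)+

lemma P5_free_imp_no_induced_path:
  assumes G: "simple_graph G" and free: "induced_free (path_graph 5) G"
    and e: "adjacent G a b" "adjacent G b c" "adjacent G c d" "adjacent G d e"
    and n: "\<not> adjacent G a c" "\<not> adjacent G a d" "\<not> adjacent G a e"
      "\<not> adjacent G b d" "\<not> adjacent G b e" "\<not> adjacent G c e"
  shows False
proof -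
  let ?S = "{a, b, c, d, e}"
  define f where "f x = (if x = a then 0 else if x = b then 1 else if x = c then 2
    else if x = d then 3 else (4::nat))" for x
  have irr: "\<not> adjacent G x x" for x
    using adjacent_in_verts(3)[OF G] by blast
  have V: "?S \<subseteq> verts G"
    using e adjacent_in_verts[OF G] by blast
  \<comment> \<open>Consecutive vertices differ because there are no loops. Any two others are told
    apart by a third vertex of the path adjacent to exactly one of them.\<close>
  have dist: "a \<noteq> b" "a \<noteq> c" "a \<noteq> d" "a \<noteq> e" "b \<noteq> c" "b \<noteq> d" "b \<noteq> e" "c \<noteq> d" "c \<noteq> e" "d \<noteq> e"
    using e n irr adjacent_commute by metis+
  have f: "f a = 0" "f b = 1" "f c = 2" "f d = 3" "f e = 4"
    using dist by (auto simp: f_def)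
  have "bij_betw f ?S {..<5}"
    unfolding bij_betw_def
  proof
    show "inj_on f ?S"
      using f by (auto simp: inj_on_def)
    have "{..<5} = {0, 1, 2, 3, 4::nat}" by auto
    then show "f ` ?S = {..<5}"
      using f by auto
  qed
  moreover have "adjacent (induced_subgraph G ?S) x y \<longleftrightarrow> adjacent G x y" if "x \<in> ?S" "y \<in> ?S" for x y
    using that by (auto simp: adjacent_def induced_subgraph_def)
  moreover have "adjacent (path_graph 5) i j \<longleftrightarrow> (j = Suc i \<or> i = Suc j)" if "i < 5" "j < 5" for i j
    using that by (auto simp: adjacent_def path_graph_def doubleton_eq_iff)
  moreover have "adjacent G x y \<longleftrightarrow> (f y = Suc (f x) \<or> f x = Suc (f y))" if "x \<in> ?S" "y \<in> ?S" for x y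
    using that e n irr f adjacent_commute[of G] by (elim insertE) (simp_all add: f)
  moreover have "f x < 5" for x
    by (simp add: f_def)
  ultimately have "isomorphic (induced_subgraph G ?S) (path_graph 5)"
    unfolding isomorphic_def
    by (intro exI[of _ f]) (auto simp: induced_subgraph_def path_graph_def)
  then show False
    using free V unfolding induced_free_def by blast
qed

lemma connected_graph_crossing_edge:
  assumes "connected_graph G" "a \<in> S" "a \<in> verts G" "b \<notin> S" "b \<in> verts G"
  obtains w w' where "w \<in> S" "w' \<notin> S" "adjacent G w w'"
proof -
  have "(adjacent G)\<^sup>*\<^sup>* a b"
    using assms unfolding connected_graph_def by blast
  then have "\<exists>w w'. w \<in> S \<and> w' \<notin> S \<and> adjacent G w w'"
    using assms(2,4) by (induction rule: rtranclp_induct) blast+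
  then show thesis
    using that by blast
qed

lemma dominating_set_alt:
  "dominating_set G D \<longleftrightarrow> D \<subseteq> verts G \<and> (\<forall>z\<in>verts G. \<exists>d\<in>D. z = d \<or> adjacent G z d)"
  unfolding dominating_set_def by blast

text \<open>
  Vertices are exchanged in \<open>D\<close> under the assumption that no dominating set as small as \<open>D\<close>
  contains an edge. Every exchange that would produce such a set fails at some undominated
  vertex, and the undominated vertex completes an induced path on five vertices.
\<close>

locale independent_dominating =
  fixes G :: "'a graph" and D :: "'a set"
  assumes simple: "simple_graph G"
    and conn: "connected_graph G"
    and free: "induced_free (path_graph 5) G"
    and dom: "dominating_set G D"
    and edgeless: "\<And>D' u v. dominating_set G D' \<Longrightarrow> card D' \<le> card D \<Longrightarrow> u \<in> D' \<Longrightarrow> v \<in> D' \<Longrightarrow>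
      \<not> adjacent G u v"
begin

section \<open>Exchanges, private neighbours and common neighbours\<close>

abbreviation adj (infix "\<sim>" 50) where "u \<sim> v \<equiv> adjacent G u v"

lemma sym: "u \<sim> v \<Longrightarrow> v \<sim> u"
  using adjacent_commute by metis

lemmas no_P5 = P5_free_imp_no_induced_path[OF simple free]

lemma DV: "d \<in> D \<Longrightarrow> d \<in> verts G"
  using dom by (auto simp: dominating_set_def)

lemma D_indep: "d \<in> D \<Longrightarrow> e \<in> D \<Longrightarrow> \<not> d \<sim> e"
  using edgeless[OF dom] by blast

text \<open>The set \<open>D - X \<union> Y\<close> is no larger than \<open>D\<close> and contains
  the edge \<open>uv\<close>, so \<open>edgeless\<close> forbids it to dominate. A vertex
  \<open>z\<close> that it misses sees no member of \<open>Y\<close>, and only \<open>X\<close> can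
  dominate it within \<open>D\<close>.\<close>

lemma exchange:
  assumes "X \<subseteq> D" "Y \<subseteq> verts G" "card Y \<le> card X"
    and "u \<in> D - X \<union> Y" "v \<in> Y" "u \<sim> v"
  obtains z where "z \<in> verts G" "\<And>d. d \<in> D \<Longrightarrow> z = d \<or> z \<sim> d \<Longrightarrow> d \<in> X"
    "\<And>y. y \<in> Y \<Longrightarrow> z \<noteq> y \<and> \<not> z \<sim> y"
proof -
  have fin: "finite (verts G)"
    using simple by (simp add: simple_graph_def)
  then have "finite D" "finite Y"
    using dom assms(2) finite_subset by (auto simp: dominating_set_def)
  have "card (D - X \<union> Y) \<le> card (D - X) + card Y"
    by (rule card_Un_le)
  also have "\<dots> = card D - card X + card Y"
    using \<open>X \<subseteq> D\<close> \<open>finite D\<close> by (simp add: card_Diff_subset finite_subset)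
  also have "\<dots> \<le> card D"
    using assms(3) card_mono[OF \<open>finite D\<close> \<open>X \<subseteq> D\<close>] by simp
  finally have "\<not> dominating_set G (D - X \<union> Y)"
    using edgeless[of "D - X \<union> Y" u v] assms by blast
  moreover have "D - X \<union> Y \<subseteq> verts G"
    using assms(2) DV by blast
  ultimately obtain z where "z \<in> verts G" "\<forall>d\<in>D - X \<union> Y. z \<noteq> d \<and> \<not> z \<sim> d"
    unfolding dominating_set_alt by blast
  then show thesis
    using that by blast
qed

text \<open>For \<open>d\<close> in \<open>D\<close> this is an external private neighbour:
  \<open>D\<close> is independent, so \<open>q\<close> lies outside \<open>D\<close>.\<close>

definition private_nbr :: "'a \<Rightarrow> 'a \<Rightarrow> bool" where
  "private_nbr d q \<longleftrightarrow> q \<sim> d \<and> (\<forall>e\<in>D. q \<sim> e \<longrightarrow> e = d)"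

text \<open>Exchange \<open>d\<close> for \<open>x\<close>, which forms an edge with the remaining
  vertex \<open>d'\<close>. The undominated vertex is the required \<open>q\<close>; it is not
  \<open>d\<close> itself because \<open>x\<close> dominates \<open>d\<close>.\<close>

lemma private_nonneighbor:
  assumes d: "d \<in> D" "d' \<in> D" "d \<noteq> d'" and x: "x \<sim> d" "x \<sim> d'"
  obtains q where "private_nbr d q" "\<not> q \<sim> x"
proof -
  have "x \<in> verts G"
    using x adjacent_in_verts[OF simple] by blast
  then obtain z where z: "z \<in> verts G" "\<And>e. e \<in> D \<Longrightarrow> z = e \<or> z \<sim> e \<Longrightarrow> e \<in> {d}"
    "\<And>y. y \<in> {x} \<Longrightarrow> z \<noteq> y \<and> \<not> z \<sim> y"
    using exchange[of "{d}" "{x}" d' x] d x sym by auto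
  moreover obtain e where "e \<in> D" "z = e \<or> z \<sim> e"
    using dom z(1) unfolding dominating_set_alt by blast
  ultimately have "private_nbr d z"
    using x sym unfolding private_nbr_def by blast
  then show thesis
    using that z(3) by blast
qed

text \<open>Otherwise \<open>q d x d' q'\<close> is an induced path.\<close>

lemma private_nonneighbors_adjacent:
  assumes "d \<in> D" "d' \<in> D" "d \<noteq> d'" and "x \<sim> d" "x \<sim> d'"
    and "private_nbr d q" "\<not> q \<sim> x" "private_nbr d' q'" "\<not> q' \<sim> x"
  shows "q \<sim> q'"
  using no_P5[of q d x d' q'] assms D_indep sym unfolding private_nbr_def by metis

text \<open>Let \<open>q\<close> be private to \<open>d3\<close> and not adjacent to
  \<open>x\<close>, and exchange \<open>d1\<close>, \<open>d2\<close> for \<open>x\<close>,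
  \<open>q\<close>, which creates the edge from \<open>x\<close> to \<open>d3\<close>. If the
  undominated \<open>z\<close> is private to \<open>d1\<close> or \<open>d2\<close>, it must be
  adjacent to \<open>q\<close>; if it sees both, then \<open>z d1 x d3 q\<close> is an induced
  path.\<close>

lemma no_three_neighbors:
  assumes d: "d1 \<in> D" "d2 \<in> D" "d3 \<in> D" "d1 \<noteq> d2" "d1 \<noteq> d3" "d2 \<noteq> d3"
    and x: "x \<sim> d1" "x \<sim> d2" "x \<sim> d3"
  shows False
proof -
  obtain q where q: "private_nbr d3 q" "\<not> q \<sim> x"
    using private_nonneighbor[of d3 d1 x] d x by metis
  have V: "{x, q} \<subseteq> verts G"
    using x q adjacent_in_verts[OF simple] unfolding private_nbr_def by blast
  have "card {x, q} \<le> 2"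
    by (simp add: card_insert_if)
  then obtain z where z: "z \<in> verts G" "\<And>e. e \<in> D \<Longrightarrow> z = e \<or> z \<sim> e \<Longrightarrow> e \<in> {d1, d2}"
    "\<And>y. y \<in> {x, q} \<Longrightarrow> z \<noteq> y \<and> \<not> z \<sim> y"
    using exchange[of "{d1, d2}" "{x, q}" d3 x] d x sym V by auto
  obtain e where e: "e \<in> D" "z = e \<or> z \<sim> e"
    using dom z(1) unfolding dominating_set_alt by blast
  have z12: "z \<noteq> d1" "z \<noteq> d2"
    using z(3) x sym by blast+
  then consider "private_nbr d1 z" | "private_nbr d2 z" | "z \<sim> d1" "z \<sim> d2"
    using z(2) e unfolding private_nbr_def by blast
  then show False
  proof cases
    case 1
    then show False
      using private_nonneighbors_adjacent[of d1 d3 x z q] d x q z(3) by blast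
  next
    case 2
    then show False
      using private_nonneighbors_adjacent[of d2 d3 x z q] d x q z(3) by blast
  next
    case 3
    have "\<not> z \<sim> d3"
      using z(2) d by blast
    then show False
      using no_P5[of z d1 x d3 q] 3 d x q z(3) D_indep sym unfolding private_nbr_def by blast
  qed
qed

text \<open>The common neighbours \<open>x\<close> and \<open>w\<close> are adjacent, as otherwise
  \<open>d2 x d1 w d3\<close> is induced. They may therefore be exchanged in together, and every
  possible neighbourhood of the undominated vertex in \<open>D\<close> is contradictory.\<close>

lemma no_two_shared:
  assumes d: "d1 \<in> D" "d2 \<in> D" "d3 \<in> D" "d1 \<noteq> d2" "d1 \<noteq> d3" "d2 \<noteq> d3"
    and x: "x \<sim> d1" "x \<sim> d2" and w: "w \<sim> d1" "w \<sim> d3"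
  shows False
proof -
  have nx: "\<not> x \<sim> d3" and nw: "\<not> w \<sim> d2"
    using no_three_neighbors d x w by blast+
  have nd: "\<not> d1 \<sim> d2" "\<not> d1 \<sim> d3" "\<not> d2 \<sim> d3"
    using d D_indep by blast+
  have xw: "x \<sim> w"
    using no_P5[of d2 x d1 w d3] x w nx nw nd sym by blast
  obtain q where q: "private_nbr d2 q" "\<not> q \<sim> x"
    using private_nonneighbor[of d2 d1 x] d x by metis
  have V: "{x, w, q} \<subseteq> verts G"
    using x w q adjacent_in_verts[OF simple] unfolding private_nbr_def by blast
  have "card {x, w, q} \<le> 3"
    by (simp add: card_insert_if)
  \<comment> \<open>The third new vertex \<open>q\<close> serves the case in which \<open>z\<close>
    is private to \<open>d1\<close>; in all other cases an induced path arises without it.\<close>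
  then obtain z where z: "z \<in> verts G" "\<And>e. e \<in> D \<Longrightarrow> z = e \<or> z \<sim> e \<Longrightarrow> e \<in> {d1, d2, d3}"
    "\<And>y. y \<in> {x, w, q} \<Longrightarrow> z \<noteq> y \<and> \<not> z \<sim> y"
    using exchange[of "{d1, d2, d3}" "{x, w, q}" x w] d xw V by auto
  have nz: "\<not> z \<sim> x" "\<not> z \<sim> w" "\<not> z \<sim> q"
    using z(3) by blast+
  obtain e where e: "e \<in> D" "z = e \<or> z \<sim> e"
    using dom z(1) unfolding dominating_set_alt by blast
  have "z \<noteq> d1" "z \<noteq> d2" "z \<noteq> d3"
    using z(3) x w sym by blast+
  then have "z \<sim> d1 \<or> z \<sim> d2 \<or> z \<sim> d3"
    using z(2) e by blast
  moreover have "\<not> (z \<sim> d1 \<and> z \<sim> d2 \<and> z \<sim> d3)"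
    using no_three_neighbors d by blast
  ultimately consider "z \<sim> d1" "\<not> z \<sim> d2" "\<not> z \<sim> d3" | "z \<sim> d2" "\<not> z \<sim> d1" "\<not> z \<sim> d3"
    | "z \<sim> d3" "\<not> z \<sim> d1" "\<not> z \<sim> d2" | "z \<sim> d1" "z \<sim> d2" "\<not> z \<sim> d3"
    | "z \<sim> d1" "z \<sim> d3" "\<not> z \<sim> d2" | "z \<sim> d2" "z \<sim> d3" "\<not> z \<sim> d1"
    by blast
  then show False
  proof cases
    case 1
    then have "private_nbr d1 z"
      using z(2) unfolding private_nbr_def by blast
    then show False
      using private_nonneighbors_adjacent[of d1 d2 x z q] d x q nz by blast
  next
    case 2
    then show False
      using no_P5[of z d2 x w d3] x w nx nw nd nz xw sym by blast
  next
    case 3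
    then show False
      using no_P5[of z d3 w x d2] x w nx nw nd nz xw sym by blast
  next
    case 4
    then show False
      using no_P5[of d2 z d1 w d3] w nw nd nz sym by blast
  next
    case 5
    then show False
      using no_P5[of d3 z d1 x d2] x nx nd nz sym by blast
  next
    case 6
    then show False
      using no_P5[of d3 z d2 x d1] x nx nd nz sym by blast
  qed
qed

text \<open>Exchange \<open>d1\<close>, \<open>d2\<close> for the edge \<open>pr\<close>. If the
  undominated vertex saw just one of \<open>d1\<close>, \<open>d2\<close>, it would extend the path
  through \<open>p\<close> and \<open>r\<close> to the other one to an induced path on five
  vertices.\<close>

lemma private_edge_shared:
  assumes d: "d1 \<in> D" "d2 \<in> D" "d1 \<noteq> d2"
    and p: "private_nbr d1 p" and r: "private_nbr d2 r" and pr: "p \<sim> r"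
  obtains z where "z \<sim> d1" "z \<sim> d2"
proof -
  have V: "{p, r} \<subseteq> verts G"
    using pr adjacent_in_verts[OF simple] by blast
  have "card {p, r} \<le> 2"
    by (simp add: card_insert_if)
  then obtain z where z: "z \<in> verts G" "\<And>e. e \<in> D \<Longrightarrow> z = e \<or> z \<sim> e \<Longrightarrow> e \<in> {d1, d2}"
    "\<And>y. y \<in> {p, r} \<Longrightarrow> z \<noteq> y \<and> \<not> z \<sim> y"
    using exchange[of "{d1, d2}" "{p, r}" p r] d pr V by auto
  have n: "\<not> z \<sim> p" "\<not> z \<sim> r" "\<not> d1 \<sim> d2" "\<not> p \<sim> d2" "\<not> r \<sim> d1"
    using z(3) d D_indep p r unfolding private_nbr_def by blast+
  obtain e where e: "e \<in> D" "z = e \<or> z \<sim> e"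
    using dom z(1) unfolding dominating_set_alt by blast
  have "z \<noteq> d1" "z \<noteq> d2"
    using z(3) p r sym unfolding private_nbr_def by blast+
  then have "z \<sim> d1 \<or> z \<sim> d2"
    using z(2) e by blast
  moreover have "z \<sim> d2" if "z \<sim> d1"
    using no_P5[of z d1 p r d2] that n p r pr sym unfolding private_nbr_def by blast
  moreover have "z \<sim> d1" if "z \<sim> d2"
    using no_P5[of z d2 r p d1] that n p r pr sym unfolding private_nbr_def by blast
  ultimately show thesis
    using that by blast
qed

text \<open>Exchange \<open>d1\<close>, \<open>d4\<close> for the edge \<open>pw\<close> and keep
  \<open>d3\<close>, so that the undominated \<open>z\<close> misses \<open>d3\<close>. Then
  \<open>z d1 p w d3\<close> rules out \<open>z \<sim> d1\<close>, and \<open>z d4 w p d1\<close>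
  rules out that \<open>z\<close> sees \<open>d4\<close> alone.\<close>

lemma no_private_shared_edge:
  assumes d: "d1 \<in> D" "d3 \<in> D" "d4 \<in> D" "d1 \<noteq> d3" "d1 \<noteq> d4" "d3 \<noteq> d4"
    and p: "private_nbr d1 p" and w: "w \<sim> d3" "w \<sim> d4" and pw: "p \<sim> w"
  shows False
proof -
  have V: "{p, w} \<subseteq> verts G"
    using pw adjacent_in_verts[OF simple] by blast
  have "card {p, w} \<le> 2"
    by (simp add: card_insert_if)
  then obtain z where z: "z \<in> verts G" "\<And>e. e \<in> D \<Longrightarrow> z = e \<or> z \<sim> e \<Longrightarrow> e \<in> {d1, d4}"
    "\<And>y. y \<in> {p, w} \<Longrightarrow> z \<noteq> y \<and> \<not> z \<sim> y"
    using exchange[of "{d1, d4}" "{p, w}" p w] d pw V by auto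
  have n: "\<not> z \<sim> p" "\<not> z \<sim> w" "\<not> z \<sim> d3" "\<not> d1 \<sim> d3" "\<not> d1 \<sim> d4" "\<not> p \<sim> d3" "\<not> p \<sim> d4"
    using z(2,3) d D_indep p unfolding private_nbr_def by blast+
  have nw: "\<not> w \<sim> d1"
    using no_three_neighbors d w by blast
  obtain e where e: "e \<in> D" "z = e \<or> z \<sim> e"
    using dom z(1) unfolding dominating_set_alt by blast
  have "z \<noteq> d1" "z \<noteq> d4"
    using z(3) p w sym unfolding private_nbr_def by blast+
  then have "z \<sim> d1 \<or> z \<sim> d4"
    using z(2) e by blast
  moreover have "\<not> z \<sim> d1"
    using no_P5[of z d1 p w d3] n nw p w pw sym unfolding private_nbr_def by blast
  moreover have "z \<sim> d1" if "z \<sim> d4"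
    using no_P5[of z d4 w p d1] that n nw p w pw sym unfolding private_nbr_def by blast
  ultimately show False
    by blast
qed

section \<open>Connectedness bounds the size of \<open>D\<close>\<close>

lemma neighbor_unless_in_D:
  assumes "z \<in> verts G" "z \<notin> D"
  obtains d where "d \<in> D" "z \<sim> d"
  using dom assms unfolding dominating_set_def by blast

text \<open>Suppose no vertex is shared. An edge leaving the closed neighbourhood of
  \<open>d1\<close> then joins private neighbours of two members of \<open>D\<close>, and
  \<open>private_edge_shared\<close> yields a shared vertex after all.\<close>

lemma exists_shared:
  assumes "card D \<ge> 2"
  obtains d1 d2 x where "d1 \<in> D" "d2 \<in> D" "d1 \<noteq> d2" "x \<sim> d1" "x \<sim> d2"
proof (rule ccontr)
  assume "\<not> thesis"
  with that have uniq: "d = e" if "d \<in> D" "e \<in> D" "x \<sim> d" "x \<sim> e" for d e x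
    using that by blast
  obtain d1 d2 where d: "d1 \<in> D" "d2 \<in> D" "d1 \<noteq> d2"
    using assms by (metis card_le_Suc0_iff_eq card.infinite not_less_eq_eq numeral_2_eq_2 zero_le)
  let ?S = "{y. y = d1 \<or> y \<sim> d1}"
  have "d1 \<in> ?S" "d2 \<notin> ?S"
    using d D_indep by blast+
  then obtain w w' where "w \<in> ?S" "w' \<notin> ?S" "w \<sim> w'"
    using connected_graph_crossing_edge[OF conn, of d1 ?S d2] d DV by blast
  then have w: "w = d1 \<or> w \<sim> d1" "w' \<noteq> d1" "\<not> w' \<sim> d1" "w \<sim> w'"
    by blast+
  have w1: "w \<sim> d1"
    using w sym by blast
  have "w' \<notin> D"
    using uniq d w w1 by blast
  moreover have "w' \<in> verts G"
    using w adjacent_in_verts[OF simple] by blast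
  ultimately obtain d3 where d3: "d3 \<in> D" "w' \<sim> d3"
    using neighbor_unless_in_D by blast
  have "private_nbr d1 w" "private_nbr d3 w'"
    using uniq w1 d3 d unfolding private_nbr_def by blast+
  moreover have "d1 \<noteq> d3"
    using d3 w by blast
  ultimately show False
    using private_edge_shared[of d1 d3 w w'] d d3 w uniq by blast
qed

text \<open>With a third vertex in \<open>D\<close>, some edge \<open>ww'\<close> leaves the closed
  neighbourhood of the pair \<open>d1\<close>, \<open>d2\<close> that has a common neighbour. Its
  outer end \<open>w'\<close> is adjacent to a private neighbour of \<open>d1\<close> or
  \<open>d2\<close>, whence one of the two preceding edge lemmas applies, depending on whether
  \<open>w'\<close> is private or shared.\<close>

lemma card_le_2: "card D \<le> 2"
proof (rule ccontr)
  assume "\<not> card D \<le> 2"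
  then have c: "card D \<ge> 3" and "card D \<ge> 2" by simp_all
  then obtain d1 d2 x where d: "d1 \<in> D" "d2 \<in> D" "d1 \<noteq> d2" and x: "x \<sim> d1" "x \<sim> d2"
    using exists_shared by blast
  have "card {d1, d2} < card D"
    using c d by simp
  then obtain d' where d': "d' \<in> D" "d' \<noteq> d1" "d' \<noteq> d2"
    by (metis card_mono finite.emptyI finite.insertI insertCI not_less subsetI)
  \<comment> \<open>By \<open>no_two_shared\<close>, the pair \<open>d1\<close>, \<open>d2\<close>
    is sealed off: its neighbours see no other member of \<open>D\<close>.\<close>
  have shared: "e = d1 \<or> e = d2" if "e \<in> D" "y \<sim> e" "y \<sim> d1 \<or> y \<sim> d2" for e y
    using that no_two_shared[of d1 d2 e x y] no_two_shared[of d2 d1 e x y] d x by metis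
  let ?S = "{y. y = d1 \<or> y = d2 \<or> y \<sim> d1 \<or> y \<sim> d2}"
  have "d1 \<in> ?S" "d' \<notin> ?S"
    using d d' D_indep by blast+
  then obtain w w' where "w \<in> ?S" "w' \<notin> ?S" and ww: "w \<sim> w'"
    using connected_graph_crossing_edge[OF conn, of d1 ?S d'] d d' DV by blast
  then have w: "w \<sim> d1 \<or> w \<sim> d2" and w': "w' \<noteq> d1" "w' \<noteq> d2" "\<not> w' \<sim> d1" "\<not> w' \<sim> d2"
    using sym by blast+
  have "w' \<notin> D"
    using shared w w' ww by blast
  moreover have "w' \<in> verts G"
    using ww adjacent_in_verts[OF simple] by blast
  ultimately obtain d3 where d3: "d3 \<in> D" "w' \<sim> d3"
    using neighbor_unless_in_D by blast
  have n3: "d3 \<noteq> d1" "d3 \<noteq> d2"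
    using d3 w' by blast+
  \<comment> \<open>If \<open>w\<close> sees only one of \<open>d1\<close>, \<open>d2\<close>, take
    \<open>p = w\<close>. If it sees both, take a private neighbour \<open>q\<close> of
    \<open>d1\<close> not adjacent to \<open>w\<close>; it must see \<open>w'\<close>, as otherwise
    \<open>q d1 w w' d3\<close> is induced.\<close>
  have "\<exists>p i. (i = d1 \<or> i = d2) \<and> private_nbr i p \<and> p \<sim> w'"
  proof (cases "w \<sim> d1 \<and> w \<sim> d2")
    case True
    obtain q where q: "private_nbr d1 q" "\<not> q \<sim> w"
      using private_nonneighbor[of d1 d2 w] d True by metis
    have "\<not> w \<sim> d3" "\<not> q \<sim> d3" "\<not> d1 \<sim> d3"
      using shared[of d3 w] True n3 d3 q d D_indep unfolding private_nbr_def by blast+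
    then have "q \<sim> w'"
      using no_P5[of q d1 w w' d3] q True ww w' d3 sym unfolding private_nbr_def by blast
    then show ?thesis
      using q by blast
  next
    case False
    then have "private_nbr d1 w \<or> private_nbr d2 w"
      using w shared unfolding private_nbr_def by blast
    then show ?thesis
      using ww by blast
  qed
  then obtain p i where i: "i = d1 \<or> i = d2" and p: "private_nbr i p" "p \<sim> w'"
    by blast
  show False
  proof (cases "private_nbr d3 w'")
    case True
    then obtain z where "z \<sim> i" "z \<sim> d3"
      using private_edge_shared[of i d3 p w'] i p d d3 n3 by metis
    then show False
      using shared i d3 n3 by blast
  next
    case False
    then obtain d4 where "d4 \<in> D" "w' \<sim> d4" "d4 \<noteq> d3"
      using d3 unfolding private_nbr_def by blast
    moreover have "i \<in> D" "i \<noteq> d3" "i \<noteq> d4"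
      using i d n3 w' \<open>w' \<sim> d4\<close> by blast+
    ultimately show False
      using no_private_shared_edge[of i d3 d4 p w'] p d3 by blast
  qed
qed

end

lemma P5_free_dominating_set:
  assumes "simple_graph G" "connected_graph G" "induced_free (path_graph 5) G"
    and "dominating_set G D" "card D \<ge> 2"
  obtains (edge) D' u v where "dominating_set G D'" "card D' \<le> card D" "u \<in> D'" "v \<in> D'" "adjacent G u v"
  | (shared) u v x where "D = {u, v}" "u \<noteq> v" "adjacent G x u" "adjacent G x v"
proof (cases "\<exists>D' u v. dominating_set G D' \<and> card D' \<le> card D \<and> u \<in> D' \<and> v \<in> D' \<and> adjacent G u v")
  case True
  then show thesis
    using edge by blast
next
  case False
  then interpret independent_dominating G D
    using assms by unfold_locales blast+
  obtain d1 d2 x where d: "d1 \<in> D" "d2 \<in> D" "d1 \<noteq> d2" and x: "x \<sim> d1" "x \<sim> d2"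
    using exists_shared assms(5) by blast
  have "finite D"
    using assms(5) by (metis card.infinite not_numeral_le_zero)
  then have "D = {d1, d2}"
    using card_le_2 d by (intro card_seteq[symmetric]) auto
  then show thesis
    using shared d x by blast
qed

section \<open>Domination number and edge contraction\<close>

lemma dominating_set_verts: "dominating_set G (verts G)"
  by (simp add: dominating_set_def)

lemma domination_number_le: "dominating_set G D \<Longrightarrow> domination_number G \<le> card D"
  unfolding domination_number_def by (rule Least_le) blast

lemma domination_number_attained:
  obtains D where "dominating_set G D" "card D = domination_number G"
proof -
  have "\<exists>D. dominating_set G D \<and> card D = domination_number G"
    unfolding domination_number_def
    by (rule LeastI_ex) (use dominating_set_verts in blast)
  then show thesis
    using that by blast
qed

lemma dominating_set_ne:
  assumes "finite (verts G)" "verts G \<noteq> {}" "dominating_set G D"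
  shows "card D \<ge> 1"
proof -
  have "D \<noteq> {}" "finite D"
    using assms finite_subset unfolding dominating_set_def by auto
  then show ?thesis
    by (simp add: Suc_le_eq card_gt_0_iff)
qed

lemma domination_number_pos:
  assumes "finite (verts G)" "verts G \<noteq> {}"
  shows "domination_number G \<ge> 1"
  using assms dominating_set_ne domination_number_attained by metis

lemma simple_graph_contract_edge:
  assumes "simple_graph G" "w \<notin> verts G"
  shows "simple_graph (contract_edge G u v w)"
proof -
  have "e \<in> {{a, b} |a b. a \<in> insert w (verts G - {u, v}) \<and> b \<in> insert w (verts G - {u, v}) \<and> a \<noteq> b}"
    if "e \<in> edges G" "u \<notin> e" "v \<notin> e" for e
  proof -
    have "e \<in> {{a, b} |a b. a \<in> verts G \<and> b \<in> verts G \<and> a \<noteq> b}"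
      using that(1) assms(1) unfolding simple_graph_def by blast
    then obtain a b where "e = {a, b}" "a \<in> verts G" "b \<in> verts G" "a \<noteq> b"
      by blast
    then show ?thesis
      using that by blast
  qed
  moreover have "{w, x} \<in> {{a, b} |a b. a \<in> insert w (verts G - {u, v}) \<and> b \<in> insert w (verts G - {u, v}) \<and> a \<noteq> b}"
    if "x \<in> verts G - {u, v}" for x
    using that assms(2) by blast
  ultimately show ?thesis
    using assms(1) unfolding simple_graph_def contract_edge_def graph.simps by (intro conjI subsetI) blast+
qed

lemma contracts_to_props:
  assumes "contracts_to G G'" "simple_graph G"
  shows "simple_graph G'" "verts G' \<noteq> {}"
  using assms simple_graph_contract_edge unfolding contracts_to_def
  by (auto simp: contract_edge_def)

lemma contracts_to_pow_props:
  assumes "(contracts_to ^^ i) G G'" "simple_graph G" "verts G \<noteq> {}"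
  shows "simple_graph G' \<and> verts G' \<noteq> {}"
  using assms(1)
proof (induction i arbitrary: G')
  case 0
  then show ?case
    using assms by simp
next
  case (Suc i)
  then show ?case
    using contracts_to_props by (metis relpowp_Suc_E)
qed

lemma adjacent_contract_edge:
  assumes "simple_graph G" "w \<notin> verts G"
  shows "\<lbrakk>x \<noteq> w; y \<noteq> w\<rbrakk> \<Longrightarrow> adjacent (contract_edge G u v w) x y \<longleftrightarrow>
      adjacent G x y \<and> x \<notin> {u, v} \<and> y \<notin> {u, v}"
    and "adjacent (contract_edge G u v w) x w \<longleftrightarrow>
      x \<in> verts G - {u, v} \<and> (adjacent G x u \<or> adjacent G x v)"
proof -
  have w: "\<not> adjacent G x w" for x
    using assms adjacent_in_verts by metis
  show "adjacent (contract_edge G u v w) x y \<longleftrightarrow> adjacent G x y \<and> x \<notin> {u, v} \<and> y \<notin> {u, v}"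
    if "x \<noteq> w" "y \<noteq> w"
    using that unfolding adjacent_def contract_edge_def by (auto simp: doubleton_eq_iff)
  show "adjacent (contract_edge G u v w) x w \<longleftrightarrow>
      x \<in> verts G - {u, v} \<and> (adjacent G x u \<or> adjacent G x v)"
    using w assms(2) unfolding adjacent_def contract_edge_def by (auto simp: doubleton_eq_iff)
qed

text \<open>The new vertex inherits all outside neighbours of \<open>u\<close> and \<open>v\<close>
  and so dominates whatever they did; two members are traded for one.\<close>

lemma dominating_set_contract_edge:
  assumes G: "simple_graph G" and D: "dominating_set G D" and uv: "u \<in> D" "v \<in> D" "adjacent G u v"
    and w: "w \<notin> verts G"
  shows "dominating_set (contract_edge G u v w) (insert w (D - {u, v}))"
    and "card (insert w (D - {u, v})) + 1 = card D"
proof -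
  have DV: "D \<subseteq> verts G" and fin: "finite D"
    using D G finite_subset by (auto simp: dominating_set_def simple_graph_def)
  let ?G = "contract_edge G u v w" and ?D = "insert w (D - {u, v})"
  have V: "verts ?G = insert w (verts G - {u, v})"
    by (simp add: contract_edge_def)
  have "\<exists>d\<in>?D. z = d \<or> adjacent ?G z d" if z: "z \<in> verts G - {u, v}" for z
  proof -
    obtain d where d: "d \<in> D" "z = d \<or> adjacent G z d"
      using D z unfolding dominating_set_alt by blast
    show ?thesis
    proof (cases "d \<in> {u, v}")
      case True
      then have "adjacent ?G z w"
        using d z adjacent_contract_edge(2)[OF G w] by blast
      then show ?thesis
        by blast
    next
      case False
      moreover have "d \<noteq> w" "z \<noteq> w"
        using d z DV w by blast+
      ultimately show ?thesis
        using d z adjacent_contract_edge(1)[OF G w, of z d] by blast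
    qed
  qed
  then show "dominating_set ?G ?D"
    using DV unfolding dominating_set_alt V by blast
  have "u \<noteq> v"
    using adjacent_in_verts[OF G uv(3)] by blast
  then have "card (D - {u, v}) + 2 = card D"
    using uv fin card_mono[OF fin, of "{u, v}"] by (simp add: card_Diff_subset)
  then show "card ?D + 1 = card D"
    using w DV fin by (subst card_insert_disjoint) auto
qed

lemma fresh_vertex:
  fixes G :: "nat graph"
  assumes "simple_graph G"
  obtains w where "w \<notin> verts G"
  using assms unfolding simple_graph_def by (metis ex_new_if_finite infinite_UNIV_nat)

section \<open>Criteria by universal vertices and dominating pairs\<close>

definition universal :: "'a graph \<Rightarrow> 'a \<Rightarrow> bool" where
  "universal G u \<longleftrightarrow> u \<in> verts G \<and> (\<forall>z\<in>verts G. z = u \<or> adjacent G u z)"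

text \<open>The choice \<open>u = v\<close> is allowed, so on nonempty graphs a dominating pair
  exists exactly when the domination number is at most 2, and universal vertices are the diagonal
  case.\<close>

definition dominating_pair :: "'a graph \<Rightarrow> 'a \<Rightarrow> 'a \<Rightarrow> bool" where
  "dominating_pair G u v \<longleftrightarrow> u \<in> verts G \<and> v \<in> verts G \<and>
     (\<forall>z\<in>verts G. z = u \<or> z = v \<or> adjacent G u z \<or> adjacent G v z)"

lemma dominating_pair_iff: "dominating_pair G u v \<longleftrightarrow> dominating_set G {u, v}"
  unfolding dominating_pair_def dominating_set_alt
  by (auto simp: adjacent_commute[of G u] adjacent_commute[of G v])

lemma universal_iff: "universal G u \<longleftrightarrow> dominating_set G {u}"
  unfolding universal_def dominating_set_alt
  by (auto simp: adjacent_commute[of G u])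

lemma domination_number_ge_2_iff:
  assumes "simple_graph G" "verts G \<noteq> {}"
  shows "domination_number G \<ge> 2 \<longleftrightarrow> \<not> (\<exists>u. universal G u)"
proof
  assume "domination_number G \<ge> 2"
  moreover have "domination_number G \<le> 1" if "universal G u" for u
    using domination_number_le[of G "{u}"] that by (simp add: universal_iff)
  ultimately show "\<not> (\<exists>u. universal G u)"
    by fastforce
next
  assume *: "\<not> (\<exists>u. universal G u)"
  obtain D where D: "dominating_set G D" "card D = domination_number G"
    by (rule domination_number_attained)
  have "card D \<noteq> 1"
    using * D unfolding universal_iff by (metis card_1_singletonE)
  moreover have "domination_number G \<ge> 1"
    using assms domination_number_pos unfolding simple_graph_def by blast
  ultimately show "domination_number G \<ge> 2"
    using D by simp
qed

lemma edge_contraction_gammaI: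
  fixes G :: "nat graph"
  assumes "simple_graph G" "k \<ge> 1" "dominating_set G D" "card D \<le> domination_number G"
    "u \<in> D" "v \<in> D" "adjacent G u v"
  shows "edge_contraction_gamma k G"
proof -
  obtain w where w: "w \<notin> verts G"
    by (rule fresh_vertex[OF assms(1)])
  let ?G = "contract_edge G u v w"
  have "contracts_to G ?G"
    using w assms unfolding contracts_to_def by blast
  then have "(contracts_to ^^ 1) G ?G"
    by (simp add: eq_OO)
  moreover have "domination_number ?G + 1 \<le> domination_number G"
    using dominating_set_contract_edge[OF assms(1,3,5-7) w] domination_number_le[of ?G] assms(4)
    by fastforce
  ultimately show ?thesis
    using assms(2) unfolding edge_contraction_gamma_def by blast
qed

text \<open>Contractions keep the graph nonempty, so the domination number cannot drop below
  1.\<close>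

lemma edge_contraction_gamma_imp_ge_2:
  assumes "edge_contraction_gamma k G" "simple_graph G" "verts G \<noteq> {}"
  shows "domination_number G \<ge> 2"
proof -
  obtain i G' where i: "(contracts_to ^^ i) G G'" "domination_number G' + 1 \<le> domination_number G"
    using assms(1) unfolding edge_contraction_gamma_def by (elim exE conjE)
  have "domination_number G' \<ge> 1"
    using contracts_to_pow_props[OF i(1) assms(2,3)]
    by (intro domination_number_pos) (simp_all add: simple_graph_def)
  with i(2) show ?thesis
    by simp
qed

lemma edge_contraction_gamma_2_iff:
  fixes G :: "nat graph"
  assumes G: "simple_graph G" "connected_graph G" "induced_free (path_graph 5) G"
  shows "edge_contraction_gamma 2 G \<longleftrightarrow> \<not> (\<exists>u. universal G u)"
proof -
  have ne: "verts G \<noteq> {}"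
    using G(2) by (simp add: connected_graph_def)
  have L: "edge_contraction_gamma 2 G" if ge: "domination_number G \<ge> 2"
  proof -
    obtain D where D: "dominating_set G D" "card D = domination_number G"
      by (rule domination_number_attained)
    have "card D \<ge> 2"
      using D ge by simp
    then consider (edge) D' u v where "dominating_set G D'" "card D' \<le> card D" "u \<in> D'" "v \<in> D'" "adjacent G u v"
      | (shared) u v x where "D = {u, v}" "u \<noteq> v" "adjacent G x u" "adjacent G x v"
      by (rule P5_free_dominating_set[OF G D(1)])
    then show ?thesis
    proof cases
      case (edge D' u v)
      then show ?thesis
        using edge_contraction_gammaI[of G 2 D' u v] G D by simp
    next
      case (shared u v x)
      have ad: "adjacent G u x"
        using shared adjacent_commute by metis
      have xV: "x \<in> verts G" "x \<noteq> u" "x \<noteq> v"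
        using shared adjacent_in_verts[OF G(1)] by blast+
      \<comment> \<open>Adding the common neighbour \<open>x\<close> makes the dominating set the
        vertex set of a path \<open>u x v\<close>. Contracting both edges leaves one dominating
        vertex, so the value 2 drops to 1.\<close>
      have D3: "dominating_set G {u, x, v}"
        using D(1) xV unfolding dominating_set_def shared(1) by blast
      obtain w where w: "w \<notin> verts G"
        by (rule fresh_vertex[OF G(1)])
      let ?G = "contract_edge G u x w" and ?D = "insert w ({u, x, v} - {u, x})"
      have G1: "simple_graph ?G"
        by (rule simple_graph_contract_edge[OF G(1) w])
      obtain w' where w': "w' \<notin> verts ?G"
        by (rule fresh_vertex[OF G1])
      have D1: "dominating_set ?G ?D" "card ?D + 1 = card {u, x, v}"
        by (rule dominating_set_contract_edge[OF G(1) D3 _ _ ad w]; simp)+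
      have "v \<in> verts G"
        using D(1) shared(1) by (simp add: dominating_set_def)
      then have ad1: "adjacent ?G v w"
        using shared xV adjacent_contract_edge(2)[OF G(1) w, of u x v] adjacent_commute[of G] by blast
      have v1: "v \<in> ?D" "w \<in> ?D"
        using shared(2) xV(3) by blast+
      let ?G2 = "contract_edge ?G v w w'"
      have "card {u, x, v} = 3" "domination_number G = 2"
        using shared(1,2) xV D(2) by auto
      then have "domination_number ?G2 + 1 \<le> domination_number G"
        using dominating_set_contract_edge[OF G1 D1(1) v1 ad1 w'] D1(2)
          domination_number_le[of ?G2 "insert w' (?D - {v, w})"] by linarith
      moreover have "contracts_to G ?G" "contracts_to ?G ?G2"
        using ad ad1 w w' unfolding contracts_to_def by blast+
      then have "(contracts_to ^^ 2) G ?G2"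
        by (auto simp: numeral_2_eq_2 intro!: relcomppI)
      ultimately show ?thesis
        unfolding edge_contraction_gamma_def by (intro exI[of _ 2] conjI exI[of _ ?G2]) simp_all
    qed
  qed
  have "edge_contraction_gamma 2 G \<Longrightarrow> domination_number G \<ge> 2"
    by (rule edge_contraction_gamma_imp_ge_2[OF _ G(1) ne])
  from iffI[OF this L] domination_number_ge_2_iff[OF G(1) ne] show ?thesis
    by (rule trans)
qed

text \<open>If a dominating pair exists, one contraction has to produce a universal vertex, which
  pulls back to a dominating edge. If none exists, a minimum dominating set has more than two
  vertices and \<open>P5_free_dominating_set\<close> can only return an edge.\<close>

lemma edge_contraction_gamma_1_iff:
  fixes G :: "nat graph"
  assumes G: "simple_graph G" "connected_graph G" "induced_free (path_graph 5) G"
  shows "edge_contraction_gamma 1 G \<longleftrightarrow> \<not> (\<exists>u. universal G u) \<and>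
    ((\<exists>u v. dominating_pair G u v \<and> adjacent G u v) \<or> \<not> (\<exists>u v. dominating_pair G u v))"
    (is "?L \<longleftrightarrow> ?U \<and> ?R")
proof -
  have ne: "verts G \<noteq> {}"
    using G(2) by (simp add: connected_graph_def)
  have le2: "domination_number G \<le> 2" if "dominating_pair G u v" for u v
  proof -
    have "card {u, v} \<le> 2"
      by (simp add: card_insert_if)
    then show ?thesis
      using domination_number_le[of G "{u, v}"] that by (simp add: dominating_pair_iff)
  qed
  have R: ?R if L: ?L
  proof (rule ccontr)
    assume nR: "\<not> ?R"
    then have le: "domination_number G \<le> 2"
      using le2 by blast
    obtain i G' where i: "i \<le> 1" "(contracts_to ^^ i) G G'" "domination_number G' + 1 \<le> domination_number G"
      using L unfolding edge_contraction_gamma_def by blast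
    then have "i \<noteq> 0"
      by (metis Suc_eq_plus1 not_less_eq_eq order_refl relpowp_0_E)
    with i have "i = 1"
      by simp
    then obtain u v w where uv: "adjacent G u v" and w: "w \<notin> verts G" and G': "G' = contract_edge G u v w"
      using i(2) unfolding contracts_to_def by auto
    have uvV: "u \<in> verts G" "v \<in> verts G" "u \<noteq> v"
      using adjacent_in_verts[OF G(1) uv] by auto
    have G1: "simple_graph G'"
      unfolding G' by (rule simple_graph_contract_edge[OF G(1) w])
    have "\<exists>z. universal G' z"
      using domination_number_ge_2_iff[OF G1] G' le i(3) by (simp add: contract_edge_def)
    then obtain z where z: "z \<in> verts G'" "\<And>y. y \<in> verts G' \<Longrightarrow> y = z \<or> adjacent G' y z"
      unfolding universal_def using adjacent_commute[of G'] by blast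
    have V: "verts G' = insert w (verts G - {u, v})"
      using G' by (simp add: contract_edge_def)
    note adj' = adjacent_contract_edge[OF G(1) w, where u = u and v = v, folded G']
    have "\<exists>a b. dominating_set G {a, b} \<and> adjacent G a b"
    \<comment> \<open>If the universal vertex is the new one, \<open>uv\<close> itself is a
      dominating edge. Otherwise \<open>z\<close> sees some \<open>a\<close> among \<open>u\<close>,
      \<open>v\<close>; then \<open>a\<close> dominates both of these and \<open>z\<close> dominates
      the rest.\<close>
    proof (cases "z = w")
      case True
      have "\<exists>d\<in>{u, v}. y = d \<or> adjacent G y d" if "y \<in> verts G" for y
      proof (cases "y \<in> {u, v}")
        case False
        then have "adjacent G' y w"
          using that True z(2)[of y] V w by blast
        then show ?thesis
          using adj'(2) by blast
      qed blast
      then show ?thesis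
        using uv uvV unfolding dominating_set_alt by blast
    next
      case False
      have zV: "z \<in> verts G" "z \<noteq> u" "z \<noteq> v"
        using z(1) V False by blast+
      have "adjacent G' z w"
        using z(2)[of w] V False adjacent_commute by (metis insertI1)
      then have "adjacent G z u \<or> adjacent G z v"
        using adj'(2) by blast
      then obtain a where a: "a \<in> {u, v}" "adjacent G z a"
        by blast
      have "\<exists>d\<in>{z, a}. y = d \<or> adjacent G y d" if "y \<in> verts G" for y
      proof (cases "y \<in> {u, v}")
        case True
        then show ?thesis
          using a uv adjacent_commute by (metis insertE insertI1 insertI2 singletonD)
      next
        case False
        then have "y = z \<or> adjacent G' y z"
          using that z(2)[of y] V by blast
        then show ?thesis
          using adj'(1)[of y z] zV w that \<open>z \<noteq> w\<close> by blast
      qed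
      then show ?thesis
        using a zV uvV unfolding dominating_set_alt by blast
    qed
    then show False
      using nR unfolding dominating_pair_iff by blast
  qed
  have L: ?L if "?R" and ge: "domination_number G \<ge> 2"
    using \<open>?R\<close>
  proof
    assume "\<exists>u v. dominating_pair G u v \<and> adjacent G u v"
    then obtain u v where uv: "dominating_set G {u, v}" "adjacent G u v"
      unfolding dominating_pair_iff by blast
    have "card {u, v} \<le> 2"
      by (simp add: card_insert_if)
    with ge have "card {u, v} \<le> domination_number G"
      by simp
    then show ?L
      using edge_contraction_gammaI[OF G(1) _ uv(1) _ _ _ uv(2), of 1] by simp
  next
    assume np: "\<not> (\<exists>u v. dominating_pair G u v)"
    obtain D where D: "dominating_set G D" "card D = domination_number G"
      by (rule domination_number_attained)
    have "card D \<ge> 2"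
      using D ge by simp
    then consider (edge) D' u v where "dominating_set G D'" "card D' \<le> card D" "u \<in> D'" "v \<in> D'" "adjacent G u v"
      | (shared) u v x where "D = {u, v}" "u \<noteq> v" "adjacent G x u" "adjacent G x v"
      by (rule P5_free_dominating_set[OF G D(1)])
    then show ?L
    proof cases
      case (edge D' u v)
      then show ?L
        using edge_contraction_gammaI[of G 1 D' u v] G D by simp
    next
      case (shared u v x)
      then show ?L
        using np D(1) unfolding dominating_pair_iff by blast
    qed
  qed
  note eq = domination_number_ge_2_iff[OF G(1) ne]
  show ?thesis
  proof (rule iffI)
    assume ?L
    then have "domination_number G \<ge> 2"
      by (rule edge_contraction_gamma_imp_ge_2[OF _ G(1) ne])
    from this[unfolded eq] R[OF \<open>?L\<close>] show "?U \<and> ?R" ..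
  next
    assume *: "?U \<and> ?R"
    show ?L
      by (rule L[OF conjunct2[OF *]]) (rule iffD2[OF eq conjunct1[OF *]])
  qed
qed

section \<open>A machine that classifies pairs of vertices\<close>

type_synonym entry = "bool \<times> bool \<times> bool \<times> bool"

definition pair_type :: "(nat \<Rightarrow> nat \<Rightarrow> bool) \<Rightarrow> nat \<Rightarrow> nat \<Rightarrow> nat \<Rightarrow> entry set" where
  "pair_type A n u v = (\<lambda>j. (A u j, A v j, j = u, j = v)) ` {..<n}"

definition pair_types :: "(nat \<Rightarrow> nat \<Rightarrow> bool) \<Rightarrow> nat \<Rightarrow> entry set set" where
  "pair_types A n = (\<Union>u<n. pair_type A n u ` {..<n})"

text \<open>
  Tape 0 is the input, tape 1 receives a copy of the adjacency matrix, and tapes 2 and 3 are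
  rulers of length \<open>n\<close> whose only cell with symbol \<open>2\<close> is at \<open>u\<close> and at \<open>v\<close>, respectively. For
  each pair \<open>(u, v)\<close> the heads of tapes 0 and 1 pass over rows \<open>u\<close> and \<open>v\<close> while the heads of
  tapes 2 and 3 pass over the rulers. The finite control stores the set \<open>S\<close> of symbol
  combinations seen in the current pass and the set \<open>E\<close> of all such sets so far.

  In \<open>Scan x y E S\<close> the flags tell that the previous cell of tape 2 resp. 3 carried the mark,
  which moves each mark one cell to the right during the pass. \<open>Back\<close> undoes this on tape 2 only.
  If the mark of tape 3 has left the ruler, then \<open>v\<close> was the last column, and \<open>Rewind\<close> and \<open>Mark\<close>
  reset tape 3; their flag is set only when they are used to initialise all tapes.
\<close>

datatype ctrl = Start | Accept | Reject | Copy
  | Rewind bool "entry set set" | Mark bool "entry set set"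
  | Scan bool bool "entry set set" "entry set" | Back bool "entry set set"

lemma finite_ctrl: "finite (UNIV :: ctrl set)"
proof -
  have "(UNIV :: ctrl set) \<subseteq> {Start, Accept, Reject, Copy} \<union> (\<lambda>(m, E). Rewind m E) ` UNIV \<union>
    (\<lambda>(m, E). Mark m E) ` UNIV \<union> (\<lambda>(x, y, E, S). Scan x y E S) ` UNIV \<union> (\<lambda>(x, E). Back x E) ` UNIV"
  proof
    fix q :: ctrl
    show "q \<in> {Start, Accept, Reject, Copy} \<union> (\<lambda>(m, E). Rewind m E) ` UNIV \<union>
      (\<lambda>(m, E). Mark m E) ` UNIV \<union> (\<lambda>(x, y, E, S). Scan x y E S) ` UNIV \<union> (\<lambda>(x, E). Back x E) ` UNIV"
      by (cases q) (auto simp: image_iff)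
  qed
  then show ?thesis
    by (rule finite_subset) (intro finite_UnI finite_imageI finite_class.finite_UNIV finite.intros)
qed

text \<open>\<open>Rewind\<close> ends when tape 1 reaches the blank before its first cell. Both
  ruler heads are steered by tape 2, since the rulers have equal length. \<open>Back\<close> returns
  tape 0 to the start of row \<open>u\<close>, while tape 1 already stands at row
  \<open>v + 1\<close>; likewise a change of rows leaves tape 0 in place.\<close>

fun delta :: "(entry set set \<Rightarrow> bool) \<Rightarrow> ctrl \<Rightarrow> nat \<Rightarrow> nat \<Rightarrow> nat \<Rightarrow> nat \<Rightarrow>
    ctrl \<times> (nat \<times> head_move) list" where
  "delta dec Start a b c d =
     (if a = 2 then (Start, [(a, Move_Right), (b, Stay), (1, Move_Right), (1, Move_Right)])
      else (Copy, [(a, Move_Right), (b, Stay), (c, Stay), (d, Stay)]))"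
| "delta dec Copy a b c d =
     (if a \<noteq> 0 then (Copy, [(a, Move_Right), (a, Move_Right), (c, Stay), (d, Stay)])
      else (Rewind True {}, [(a, Move_Left), (b, Move_Left), (c, Move_Left), (d, Move_Left)]))"
| "delta dec (Rewind m E) a b c d =
     (if b \<noteq> 0 then (Rewind m E, [(a, if m then Move_Left else Stay), (b, Move_Left),
        (c, if c \<noteq> 0 then Move_Left else Stay), (d, if c \<noteq> 0 then Move_Left else Stay)])
      else (Mark m E, [(a, if m then Move_Right else Stay), (b, Move_Right), (c, Move_Right), (d, Move_Right)]))"
| "delta dec (Mark m E) a b c d =
     (Scan False False E {}, [(a, Stay), (b, Stay), (if m then 2 else c, Stay), (2, Stay)])"
| "delta dec (Scan x y E S) a b c d =
     (if c \<noteq> 0 then (Scan (c = 2) (d = 2) E (insert (a = 2, b = 2, c = 2, d = 2) S),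
        [(a, Move_Right), (b, Move_Right), (if x then 2 else 1, Move_Right), (if y then 2 else 1, Move_Right)])
      else if \<not> y then (Back x (insert S E), [(a, Move_Left), (b, Stay), (c, Move_Left), (d, Move_Left)])
      else if \<not> x then (Rewind False (insert S E), [(a, Stay), (b, Move_Left), (c, Move_Left), (d, Move_Left)])
      else (if dec (insert S E) then Accept else Reject, [(a, Stay), (b, Stay), (c, Stay), (d, Stay)]))"
| "delta dec (Back x E) a b c d =
     (if c \<noteq> 0 then (Back (c = 2) E, [(a, Move_Left), (b, Stay), (if x then 2 else 1, Move_Left), (d, Move_Left)])
      else (Scan False False E {}, [(a, Move_Right), (b, Stay), (c, Move_Right), (d, Move_Right)]))"
| "delta dec Accept a b c d = (Accept, [(a, Stay), (b, Stay), (c, Stay), (d, Stay)])"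
| "delta dec Reject a b c d = (Reject, [(a, Stay), (b, Stay), (c, Stay), (d, Stay)])"

lemma length_delta: "length (snd (delta dec q a b c d)) = 4"
  by (cases q) simp_all

lemma delta_symbols:
  assumes "a < 3" "b < 3" "c < 3" "d < 3"
  shows "fst ` set (snd (delta dec q a b c d)) \<subseteq> {..<3}"
  using assms by (cases q) simp_all

section \<open>Step counting for the machine\<close>

locale pair_type_machine =
  fixes dec :: "entry set set \<Rightarrow> bool" and h :: "ctrl \<Rightarrow> nat" and N :: nat
  assumes inj_h: "inj h" and h: "h Start = 0" "h Accept = 1" "h Reject = 2"
    and h_bound: "\<And>q. h q < N" and N: "N \<ge> 3"
begin

definition M :: tm where
  "M = \<lparr>num_tapes = 4, num_states = N, num_symbols = 3,
     trans = (\<lambda>q xs. apfst h (delta dec (inv h q) (xs ! 0) (xs ! 1) (xs ! 2) (xs ! 3)))\<rparr>"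

lemma wf_M: "wf_tm M"
proof -
  have "xs ! i < 3" if "length xs = 4" "set xs \<subseteq> {..<3}" "i < 4" for xs :: "nat list" and i
    using that by (metis lessThan_iff nth_mem subsetD)
  then show ?thesis
    unfolding wf_tm_def M_def using N h_bound length_delta delta_symbols by simp
qed

abbreviation conf :: "ctrl \<Rightarrow> tape \<Rightarrow> tape \<Rightarrow> tape \<Rightarrow> tape \<Rightarrow> config" where
  "conf q t0 t1 t2 t3 \<equiv> (h q, [t0, t1, t2, t3])"

text \<open>An upper bound instead of an exact count lets step numbers be rounded up when runs are
  composed.\<close>

definition runs :: "nat \<Rightarrow> config \<Rightarrow> config \<Rightarrow> bool" where
  "runs T c c' \<longleftrightarrow> (\<exists>t\<le>T. (tm_step M ^^ t) c = c')"

lemma runs_trans [trans]: "runs T c c' \<Longrightarrow> runs T' c' c'' \<Longrightarrow> runs (T + T') c c''"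
proof -
  assume "runs T c c'" "runs T' c' c''"
  then obtain t t' where "t \<le> T" "(tm_step M ^^ t) c = c'" "t' \<le> T'" "(tm_step M ^^ t') c' = c''"
    unfolding runs_def by blast
  then show ?thesis
    unfolding runs_def by (intro exI[of _ "t' + t"]) (simp add: funpow_add)
qed

lemma runs_mono: "runs T c c' \<Longrightarrow> T \<le> T' \<Longrightarrow> runs T' c c'"
  unfolding runs_def using order_trans by blast

lemma runs_loop:
  assumes "\<And>i. i < m \<Longrightarrow> runs T (C i) (C (Suc i))"
  shows "runs (m * T) (C 0) (C m)"
  using assms
proof (induction m)
  case 0
  show ?case
    by (auto simp: runs_def intro: exI[of _ 0])
next
  case (Suc m)
  then have "runs (m * T + T) (C 0) (C (Suc m))"
    by (intro runs_trans[of _ _ "C m"]) simp_all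
  then show ?case
    by (simp add: add.commute)
qed

text \<open>The new tapes enter through equations, so that instantiating the third premise by
  \<open>refl\<close> leaves goals about single cells and head positions for the simplifier.\<close>

lemma runs_step:
  assumes q: "q \<noteq> Accept" "q \<noteq> Reject"
    and r: "delta dec q (scanned t0) (scanned t1) (scanned t2) (scanned t3) = r"
    and "fst r = q'"
    and "act (snd r ! 0) t0 = t0'" "act (snd r ! 1) t1 = t1'" "act (snd r ! 2) t2 = t2'" "act (snd r ! 3) t3 = t3'"
  shows "runs 1 (conf q t0 t1 t2 t3) (conf q' t0' t1' t2' t3')"
proof -
  have "h q \<noteq> 1" "h q \<noteq> 2"
    using q h inj_h by (metis injD)+
  moreover have "inv h (h q) = q"
    using inj_h by simp
  moreover have "length (snd r) = 4"
    using r length_delta by blast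
  then have "snd r = [snd r ! 0, snd r ! 1, snd r ! 2, snd r ! 3]"
    by (intro nth_equalityI) (auto simp: less_Suc_eq numeral_eq_Suc)
  then obtain a0 a1 a2 a3 where a: "snd r = [a0, a1, a2, a3]"
    by blast
  then have "r = (q', [a0, a1, a2, a3])"
    using assms(4) by (metis prod.collapse)
  ultimately have "tm_step M (conf q t0 t1 t2 t3) = conf q' t0' t1' t2' t3'"
    using r assms(5-) a by (simp add: M_def)
  then show ?thesis
    unfolding runs_def by (intro exI[of _ 1]) simp
qed

end

text \<open>A ruler of length \<open>n\<close> with its mark at \<open>m\<close>, of which the first \<open>j\<close> cells have already been
  shifted to the right by one.\<close>

definition mark_tape :: "nat \<Rightarrow> nat \<Rightarrow> nat \<Rightarrow> int \<Rightarrow> nat" where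
  "mark_tape n m j p = (if 0 \<le> p \<and> p < int n
     then (if p = (if p < int j then int m + 1 else int m) then 2 else 1) else 0)"

definition plain_tape :: "nat \<Rightarrow> int \<Rightarrow> nat" where
  "plain_tape n p = (if 0 \<le> p \<and> p < int n then 1 else 0)"

lemma plain_tape_simps:
  "plain_tape 0 = (\<lambda>_. 0)"
  "(plain_tape i)(int i := Suc 0) = plain_tape (Suc i)"
  "n > 0 \<Longrightarrow> (plain_tape n)(0 := 2) = mark_tape n 0 0"
  "mark_tape (Suc m) m (Suc m) = plain_tape (Suc m)"
  by (auto simp: fun_eq_iff plain_tape_def mark_tape_def)

text \<open>One step of \<open>Scan\<close>, one step of \<open>Back\<close>, and the fact that a
  completed shift is a ruler with its mark one cell further on.\<close>

lemma mark_tape_update: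
  "j < n \<Longrightarrow> (mark_tape n m j)(int j := (if j = Suc m then 2 else 1)) = mark_tape n m (Suc j)"
  "j < n \<Longrightarrow> (mark_tape n m (Suc j))(int j := (if j = m then 2 else 1)) = mark_tape n m j"
  "mark_tape n m n = mark_tape n (Suc m) 0"
  by (auto simp: fun_eq_iff mark_tape_def)

lemma mark_tape_read:
  "j < n \<Longrightarrow> mark_tape n m i (int j) \<noteq> 0"
  "j < n \<Longrightarrow> mark_tape n m j (int j) = 2 \<longleftrightarrow> j = m"
  "j < n \<Longrightarrow> mark_tape n m (Suc j) (int j) = 2 \<longleftrightarrow> j = Suc m"
  "mark_tape n m j (int n) = 0"
  "mark_tape n m j (- 1) = 0"
  by (auto simp: mark_tape_def)

section \<open>The run on an encoded graph\<close>

locale pair_type_run = pair_type_machine +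
  fixes n :: nat and A :: "nat \<Rightarrow> nat \<Rightarrow> bool" and f :: "int \<Rightarrow> nat"
  assumes n: "n > 0"
    and f_unary: "\<And>i. i < n \<Longrightarrow> f (int i) = 2"
    and f_sep: "f (int n) = 1"
    and f_matrix: "\<And>u j. u < n \<Longrightarrow> j < n \<Longrightarrow> f (int n + 1 + int u * int n + int j) = 2 \<longleftrightarrow> A u j"
    and f_nonblank: "\<And>i. i < n * n \<Longrightarrow> f (int n + 1 + int i) \<noteq> 0"
    and f_end: "f (int n + 1 + int (n * n)) = 0"
begin

definition copy :: "nat \<Rightarrow> int \<Rightarrow> nat" where
  "copy k p = (if 0 \<le> p \<and> p < int k then f (int n + 1 + p) else 0)"

lemma copy_simps:
  "copy 0 = (\<lambda>_. 0)"
  "(copy i)(int i := f (int n + 1 + int i)) = copy (Suc i)"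
  "copy (n * n) (- 1) = 0"
  by (auto simp: copy_def fun_eq_iff)

lemma copy_matrix:
  assumes "u < n" "j < n"
  shows "copy (n * n) (int u * int n + int j) = 2 \<longleftrightarrow> A u j"
proof -
  have "Suc u * n \<le> n * n"
    using assms by (intro mult_le_mono1) simp
  then have "u * n + j < n * n"
    using assms by simp
  then have "int u * int n + int j < int (n * n)"
    by (metis of_nat_add of_nat_less_iff of_nat_mult)
  then show ?thesis
    using f_matrix[OF assms] by (simp add: copy_def add.assoc)
qed

lemma run_start:
  "runs (n + 1) (conf Start (f, 0) (\<lambda>_. 0, 0) (\<lambda>_. 0, 0) (\<lambda>_. 0, 0))
    (conf Copy (f, int n + 1) (\<lambda>_. 0, 0) (plain_tape n, int n) (plain_tape n, int n))"
proof -
  define C where "C i = conf Start (f, int i) (\<lambda>_. 0, 0) (plain_tape i, int i) (plain_tape i, int i)" for i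
  have "runs (n * 1) (C 0) (C n)"
  proof (rule runs_loop)
    fix i assume "i < n"
    then show "runs 1 (C i) (C (Suc i))"
      unfolding C_def by (intro runs_step[OF _ _ refl]) (simp_all add: fun_upd_idem f_unary plain_tape_simps)
  qed
  also have "runs 1 (C n) (conf Copy (f, int n + 1) (\<lambda>_. 0, 0) (plain_tape n, int n) (plain_tape n, int n))"
    unfolding C_def by (intro runs_step[OF _ _ refl]) (simp_all add: fun_upd_idem f_sep)
  finally show ?thesis
    by (simp add: C_def plain_tape_simps)
qed

lemma run_copy:
  "runs (n * n + 1) (conf Copy (f, int n + 1) (\<lambda>_. 0, 0) (plain_tape n, int n) (plain_tape n, int n))
    (conf (Rewind True {}) (f, int n + int (n * n)) (copy (n * n), int (n * n) - 1)
      (plain_tape n, int n - 1) (plain_tape n, int n - 1))"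
proof -
  define C where "C i = conf Copy (f, int n + 1 + int i) (copy i, int i)
    (plain_tape n, int n) (plain_tape n, int n)" for i
  have "runs (n * n * 1) (C 0) (C (n * n))"
  proof (rule runs_loop)
    fix i assume "i < n * n"
    then show "runs 1 (C i) (C (Suc i))"
      unfolding C_def by (intro runs_step[OF _ _ refl]) (simp_all add: fun_upd_idem f_nonblank copy_simps)
  qed
  also have "runs 1 (C (n * n)) (conf (Rewind True {}) (f, int n + int (n * n)) (copy (n * n), int (n * n) - 1)
      (plain_tape n, int n - 1) (plain_tape n, int n - 1))"
    unfolding C_def by (intro runs_step[OF _ _ refl]) (simp_all add: fun_upd_idem f_end[simplified])
  finally show ?thesis
    by (simp add: C_def copy_simps)
qed

text \<open>The contents \<open>g'\<close> of tape 3 are arbitrary, because the heads of both rulers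
  follow tape 2.\<close>

lemma run_rewind:
  assumes g: "\<And>p. g p \<noteq> 0 \<longleftrightarrow> 0 \<le> p \<and> p < int n"
  shows "runs (n * n + 1)
    (conf (Rewind m E) (f, r) (copy (n * n), int (n * n) - 1) (g, int n - 1) (g', int n - 1))
    (conf (Mark m E) (f, if m then r - int (n * n) + 1 else r) (copy (n * n), 0) (g, 0) (g', 0))"
proof -
  \<comment> \<open>The ruler heads reach cell -1 after \<open>n\<close> steps and wait there while
    tape 1 goes back over all \<open>n * n\<close> cells.\<close>
  define pos where "pos i = max (- 1) (int n - 1 - int i)" for i
  define C where "C i = conf (Rewind m E) (f, if m then r - int i else r) (copy (n * n), int (n * n) - 1 - int i)
    (g, pos i) (g', pos i)" for i
  have "runs (n * n * 1) (C 0) (C (n * n))"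
  proof (rule runs_loop)
    fix i assume i: "i < n * n"
    have "copy (n * n) (int (n * n) - 1 - int i) = f (int n + 1 + int (n * n - 1 - i))"
      using i by (simp add: copy_def of_nat_diff del: of_nat_mult)
    moreover have "f (int n + 1 + int (n * n - 1 - i)) \<noteq> 0"
      using i by (intro f_nonblank) simp
    ultimately have "copy (n * n) (int (n * n) - 1 - int i) \<noteq> 0"
      by simp
    moreover have "pos (Suc i) = (if g (pos i) \<noteq> 0 then pos i - 1 else pos i)"
      using i unfolding g by (auto simp: pos_def)
    ultimately show "runs 1 (C i) (C (Suc i))"
      unfolding C_def by (intro runs_step[OF _ _ refl]) (simp_all del: of_nat_mult)
  qed
  also have "pos (n * n) = - 1"
    using n by (simp add: pos_def del: of_nat_mult)
  then have "runs 1 (C (n * n)) (conf (Mark m E) (f, if m then r - int (n * n) + 1 else r)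
      (copy (n * n), 0) (g, 0) (g', 0))"
    unfolding C_def by (intro runs_step[OF _ _ refl]) (simp_all add: fun_upd_idem copy_simps del: of_nat_mult)
  finally show ?thesis
    by (cases m) (simp_all add: C_def pos_def)
qed

definition ready :: "nat \<Rightarrow> nat \<Rightarrow> entry set set \<Rightarrow> config" where
  "ready u v E = conf (Scan False False E {}) (f, int n + 1 + int u * int n)
     (copy (n * n), int v * int n) (mark_tape n u 0, 0) (mark_tape n v 0, 0)"

lemma run_setup:
  "runs (n + 2 * (n * n) + 4) (conf Start (f, 0) (\<lambda>_. 0, 0) (\<lambda>_. 0, 0) (\<lambda>_. 0, 0)) (ready 0 0 {})"
proof -
  note run_start
  also note run_copy
  also have "runs (n * n + 1)
    (conf (Rewind True {}) (f, int n + int (n * n)) (copy (n * n), int (n * n) - 1)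
      (plain_tape n, int n - 1) (plain_tape n, int n - 1))
    (conf (Mark True {}) (f, int n + 1) (copy (n * n), 0) (plain_tape n, 0) (plain_tape n, 0))"
    using run_rewind[where g = "plain_tape n" and m = True and r = "int n + int (n * n)"]
    by (simp add: plain_tape_def[abs_def] del: of_nat_mult)
  also have "runs 1 (conf (Mark True {}) (f, int n + 1) (copy (n * n), 0) (plain_tape n, 0) (plain_tape n, 0))
    (ready 0 0 {})"
    unfolding ready_def using n by (intro runs_step[OF _ _ refl]) (simp_all add: plain_tape_simps)
  finally show ?thesis
    by (rule runs_mono) simp
qed

abbreviation scanned_conf :: "nat \<Rightarrow> nat \<Rightarrow> entry set set \<Rightarrow> config" where
  "scanned_conf u v E \<equiv> conf (Scan (n = Suc u) (n = Suc v) E (pair_type A n u v))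
     (f, int n + 1 + int u * int n + int n) (copy (n * n), int v * int n + int n)
     (mark_tape n u n, int n) (mark_tape n v n, int n)"

lemma run_scan:
  assumes uv: "u < n" "v < n"
  shows "runs n (ready u v E) (scanned_conf u v E)"
proof -
  \<comment> \<open>After \<open>j\<close> columns both rulers are shifted in their first
    \<open>j\<close> cells, and each flag records whether the cell just left carried the
    mark.\<close>
  define C where "C j = conf (Scan (j = Suc u) (j = Suc v) E ((\<lambda>j. (A u j, A v j, j = u, j = v)) ` {..<j}))
     (f, int n + 1 + int u * int n + int j) (copy (n * n), int v * int n + int j)
     (mark_tape n u j, int j) (mark_tape n v j, int j)" for j
  have "runs (n * 1) (C 0) (C n)"
  proof (rule runs_loop)
    fix j assume j: "j < n"
    show "runs 1 (C j) (C (Suc j))"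
      unfolding C_def
      by (intro runs_step[OF _ _ refl])
        (use uv j in \<open>simp_all add: fun_upd_idem mark_tape_read mark_tape_update f_matrix copy_matrix lessThan_Suc
          split del: if_split\<close>)
  qed
  then show ?thesis
    by (simp add: C_def ready_def pair_type_def)
qed

lemma run_next_column:
  assumes uv: "u < n" "Suc v < n"
  shows "runs (2 * n + 2) (ready u v E) (ready u (Suc v) (insert (pair_type A n u v) E))"
proof -
  let ?E = "insert (pair_type A n u v) E"
  \<comment> \<open>After \<open>i\<close> steps of \<open>Back\<close>, \<open>n - i\<close> cells
    of tape 2 are still shifted. For \<open>i = 0\<close> the flag comes from \<open>Scan\<close>: a
    mark pushed off the ruler survives only there.\<close>
  define C where "C i = conf (Back (n - i = Suc u) ?E)
     (f, int n + 1 + int u * int n + int (n - i) - 1) (copy (n * n), int v * int n + int n)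
     (mark_tape n u (n - i), int (n - i) - 1) (mark_tape n v n, int (n - i) - 1)" for i
  have "runs n (ready u v E) (scanned_conf u v E)"
    using uv by (intro run_scan) simp_all
  also have "runs 1 (scanned_conf u v E) (C 0)"
    unfolding C_def
    by (intro runs_step[OF _ _ refl]) (use uv in \<open>simp_all add: fun_upd_idem mark_tape_read\<close>)
  also have "runs (n * 1) (C 0) (C n)"
  proof (rule runs_loop)
    fix i assume "i < n"
    then obtain j where j: "n - i = Suc j" "n - Suc i = j" "j < n"
      by (metis Suc_diff_Suc diff_less_Suc less_SucE less_imp_diff_less less_irrefl)
    show "runs 1 (C i) (C (Suc i))"
      unfolding C_def j(1,2)
      by (intro runs_step[OF _ _ refl])
        (use j(3) in \<open>simp_all add: fun_upd_idem mark_tape_read mark_tape_update split del: if_split\<close>)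
  qed
  also have "runs 1 (C n) (ready u (Suc v) ?E)"
    unfolding C_def ready_def
    by (intro runs_step[OF _ _ refl])
      (simp_all add: fun_upd_idem mark_tape_read mark_tape_update algebra_simps)
  finally show ?thesis
    by (rule runs_mono) simp
qed

text \<open>The pass for the last column is left out, since the machine leaves it by another
  transition.\<close>

lemma run_row:
  assumes "u < n"
  shows "runs (n * (2 * n + 2)) (ready u 0 E) (ready u (n - 1) (E \<union> pair_type A n u ` {..<n - 1}))"
proof -
  have "runs ((n - 1) * (2 * n + 2)) (ready u 0 (E \<union> pair_type A n u ` {..<0}))
    (ready u (n - 1) (E \<union> pair_type A n u ` {..<n - 1}))"
  proof (rule runs_loop)
    fix v assume "v < n - 1"
    then show "runs (2 * n + 2) (ready u v (E \<union> pair_type A n u ` {..<v}))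
      (ready u (Suc v) (E \<union> pair_type A n u ` {..<Suc v}))"
      using run_next_column[of u v] assms by (simp add: lessThan_Suc)
  qed
  moreover have "(n - 1) * (2 * n + 2) \<le> n * (2 * n + 2)"
    by (intro mult_le_mono1) simp
  ultimately have "runs (n * (2 * n + 2)) (ready u 0 (E \<union> pair_type A n u ` {..<0}))
    (ready u (n - 1) (E \<union> pair_type A n u ` {..<n - 1}))"
    by (rule runs_mono)
  then show ?thesis
    by simp
qed

lemma insert_last:
  "insert (pair_type A n u (n - 1)) (E \<union> pair_type A n u ` {..<n - 1}) = E \<union> pair_type A n u ` {..<n}"
proof -
  have "{..<n} = insert (n - 1) {..<n - 1}"
    using n by auto
  then show ?thesis
    by simp
qed

lemma run_next_row:
  assumes u: "Suc u < n"
  shows "runs (n * (2 * n + 2) + n * n + n + 3) (ready u 0 E) (ready (Suc u) 0 (E \<union> pair_type A n u ` {..<n}))"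
proof -
  let ?E = "E \<union> pair_type A n u ` {..<n - 1}" and ?E' = "E \<union> pair_type A n u ` {..<n}"
  have n1: "n = Suc (n - 1)"
    using n by simp
  \<comment> \<open>In the last column the shift pushes the mark off tape 3, which is how the
    machine recognises the end of a row.\<close>
  have plain: "mark_tape n (n - 1) n = plain_tape n"
    using plain_tape_simps(4)[of "n - 1"] n1 by simp
  have "runs (n * (2 * n + 2)) (ready u 0 E) (ready u (n - 1) ?E)"
    using u by (intro run_row) simp
  also have "runs n (ready u (n - 1) ?E) (scanned_conf u (n - 1) ?E)"
    using u by (intro run_scan) simp_all
  also have "runs 1 (scanned_conf u (n - 1) ?E) (conf (Rewind False ?E')
    (f, int n + 1 + int u * int n + int n) (copy (n * n), int (n * n) - 1)
    (mark_tape n u n, int n - 1) (plain_tape n, int n - 1))"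
    using n
    by (intro runs_step[OF _ _ refl])
      (use u in \<open>simp_all add: fun_upd_idem mark_tape_read plain insert_last of_nat_diff algebra_simps
          del: One_nat_def\<close>)
  also have "runs (n * n + 1) (conf (Rewind False ?E')
      (f, int n + 1 + int u * int n + int n) (copy (n * n), int (n * n) - 1)
      (mark_tape n u n, int n - 1) (plain_tape n, int n - 1))
    (conf (Mark False ?E')
      (f, int n + 1 + int u * int n + int n) (copy (n * n), 0) (mark_tape n u n, 0) (plain_tape n, 0))"
    using run_rewind[where g = "mark_tape n u n" and m = False] by (simp add: mark_tape_def[abs_def])
  also have "runs 1 (conf (Mark False ?E')
      (f, int n + 1 + int u * int n + int n) (copy (n * n), 0) (mark_tape n u n, 0) (plain_tape n, 0))
    (ready (Suc u) 0 ?E')"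
    unfolding ready_def using n
    by (intro runs_step[OF _ _ refl])
      (simp_all add: plain_tape_simps mark_tape_update algebra_simps)
  finally show ?thesis
    by (rule runs_mono) simp
qed

lemma run_all:
  obtains t0 t1 t2 t3 where
    "runs (4 * (n + 1 + n * n)\<^sup>2) (conf Start (f, 0) (\<lambda>_. 0, 0) (\<lambda>_. 0, 0) (\<lambda>_. 0, 0))
      (conf (if dec (pair_types A n) then Accept else Reject) t0 t1 t2 t3)"
proof -
  let ?R = "n * (2 * n + 2) + n * n + n + 3"
  let ?U = "\<lambda>u. \<Union>i<u. pair_type A n i ` {..<n}"
  let ?E = "?U (n - 1) \<union> pair_type A n (n - 1) ` {..<n - 1}"
  let ?out = "if dec (pair_types A n) then Accept else Reject"
  have "?U (n - 1) \<union> pair_type A n (n - 1) ` {..<n} = ?U (Suc (n - 1))"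
    by (auto simp: lessThan_Suc)
  then have E: "insert (pair_type A n (n - 1) (n - 1)) ?E = pair_types A n"
    unfolding insert_last pair_types_def using n by simp
  have "runs (n + 2 * (n * n) + 4) (conf Start (f, 0) (\<lambda>_. 0, 0) (\<lambda>_. 0, 0) (\<lambda>_. 0, 0)) (ready 0 0 (?U 0))"
    using run_setup by simp
  also have "runs ((n - 1) * ?R) (ready 0 0 (?U 0)) (ready (n - 1) 0 (?U (n - 1)))"
  proof (rule runs_loop)
    fix u assume "u < n - 1"
    then show "runs ?R (ready u 0 (?U u)) (ready (Suc u) 0 (?U (Suc u)))"
      using run_next_row[of u "?U u"] by (simp add: lessThan_Suc Un_commute)
  qed
  also have "runs (n * (2 * n + 2)) (ready (n - 1) 0 (?U (n - 1))) (ready (n - 1) (n - 1) ?E)"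
    using n by (intro run_row) simp
  also have "runs n (ready (n - 1) (n - 1) ?E) (scanned_conf (n - 1) (n - 1) ?E)"
    using n by (intro run_scan) simp_all
  also have "runs 1 (scanned_conf (n - 1) (n - 1) ?E) (conf ?out
     (f, int n + 1 + int (n - 1) * int n + int n) (copy (n * n), int (n - 1) * int n + int n)
     (mark_tape n (n - 1) n, int n) (mark_tape n (n - 1) n, int n))"
    by (intro runs_step[OF _ _ refl]) (use n E in \<open>simp_all add: fun_upd_idem mark_tape_read\<close>)
  finally have "runs (n + 2 * (n * n) + 4 + (n - 1) * ?R + n * (2 * n + 2) + n + 1)
    (conf Start (f, 0) (\<lambda>_. 0, 0) (\<lambda>_. 0, 0) (\<lambda>_. 0, 0)) (conf ?out
     (f, int n + 1 + int (n - 1) * int n + int n) (copy (n * n), int (n - 1) * int n + int n)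
     (mark_tape n (n - 1) n, int n) (mark_tape n (n - 1) n, int n))" .
  \<comment> \<open>The total is cubic in \<open>n\<close>, whereas \<open>n + 1 + n * n\<close> is
    the length of the input.\<close>
  moreover have "n + 2 * (n * n) + 4 + (n - 1) * ?R + n * (2 * n + 2) + n + 1 \<le> 4 * (n + 1 + n * n)\<^sup>2"
  proof -
    obtain m where "n = Suc m"
      using n by (cases n) auto
    then show ?thesis
      by (simp add: algebra_simps power2_eq_square)
  qed
  ultimately show thesis
    using that runs_mono by blast
qed

end

section \<open>From the encoding to polynomial time\<close>

lemma nth_concat_rows:
  assumes "u < m" "j < n"
  shows "concat (map (\<lambda>i. map (g i) [0..<n]) [0..<m]) ! (u * n + j) = g u j"
  using assms(1)
proof (induction m)
  case (Suc m)
  have len: "length (concat (map (\<lambda>i. map (g i) [0..<n]) [0..<m])) = m * n"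
    by (induction m) simp_all
  show ?case
  proof (cases "u = m")
    case True
    then show ?thesis
      using len assms(2) by (simp add: nth_append)
  next
    case False
    then have "u < m" using Suc by simp
    then have "Suc u * n \<le> m * n"
      by (intro mult_le_mono1) simp
    then have "u * n + j < m * n"
      using assms(2) by simp
    then show ?thesis
      using len Suc.IH \<open>u < m\<close> by (simp add: nth_append)
  qed
qed simp

text \<open>The predicate \<open>dec\<close> is arbitrary: its argument ranges over a finite type,
  so its values are part of the transition table.\<close>

lemma poly_time_solvable_on_pair_types:
  fixes dec :: "entry set set \<Rightarrow> bool"
  shows "poly_time_solvable_on (\<lambda>G. verts G \<noteq> {}) (\<lambda>G. dec (pair_types (adjacent G) (card (verts G))))"
proof -
  obtain g :: "ctrl \<Rightarrow> nat" and K where g: "g ` UNIV = {i. i < K}" "inj g"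
    using finite_imp_inj_to_nat_seg[OF finite_ctrl] by blast
  \<comment> \<open>The offset 3 keeps all other control states clear of the prescribed initial,
    accepting and rejecting numbers.\<close>
  define h where "h q = (case q of Start \<Rightarrow> 0 | Accept \<Rightarrow> 1 | Reject \<Rightarrow> 2 | _ \<Rightarrow> 3 + g q)" for q
  have "inj h"
  proof (rule injI)
    fix q q' assume "h q = h q'"
    then have "q = q' \<or> g q = g q'"
      by (simp add: h_def split: ctrl.splits)
    then show "q = q'"
      using g(2) by (metis injD)
  qed
  moreover have "h q < 3 + K" for q
  proof -
    have "g q' < K" for q'
      using g(1) by blast
    then show ?thesis
      by (simp add: h_def split: ctrl.splits)
  qed
  ultimately interpret pair_type_machine dec h "3 + K"
    by unfold_locales (simp_all add: h_def)
  have "let x = encode_graph G; T = poly (monom 4 2) (length x)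
        in if dec (pair_types (adjacent G) (card (verts G))) then accepts_within M x T else rejects_within M x T"
    if V: "verts G = {..<n}" "verts G \<noteq> {}" for G n
  proof -
    let ?x = "encode_graph G" and ?f = "fst (input_tape (encode_graph G))"
    let ?rows = "concat (map (\<lambda>i. map (adjacent G i) [0..<n]) [0..<n])"
    have x: "?x = replicate n True @ False # ?rows"
      using V by (simp add: encode_graph_def)
    have rows: "length ?rows = n * n"
      by (simp add: length_concat comp_def sum_list_triv)
    have len: "length ?x = n + 1 + n * n"
      unfolding x using rows by simp
    have f: "?f (int i) = (if i < length ?x then (if ?x ! i then 2 else 1) else 0)" for i
      by (simp add: input_tape_def)
    have xr: "?x ! (n + 1 + i) = ?rows ! i" for i
      unfolding x by (simp add: nth_append)
    interpret pair_type_run dec h "3 + K" n "adjacent G" ?f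
    proof
      show "n > 0"
        using V by auto
      show "?f (int i) = 2" if "i < n" for i
        unfolding f len using that by (simp add: x nth_append)
      show "?f (int n) = 1"
        unfolding f len by (simp add: x nth_append)
      show "?f (int n + 1 + int u * int n + int j) = 2 \<longleftrightarrow> adjacent G u j" if "u < n" "j < n" for u j
      proof -
        have "Suc u * n \<le> n * n"
          using that by (intro mult_le_mono1) simp
        then have "n + 1 + (u * n + j) < n + 1 + n * n"
          using that by simp
        then show ?thesis
          using f[of "n + 1 + (u * n + j)"] xr[of "u * n + j"] nth_concat_rows[OF that, of "adjacent G"]
          unfolding len by (simp add: ac_simps)
      qed
      show "?f (int n + 1 + int i) \<noteq> 0" if "i < n * n" for i
        using f[of "n + 1 + i"] that unfolding len by (simp add: ac_simps split: if_splits)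
      show "?f (int n + 1 + int (n * n)) = 0"
        using f[of "n + 1 + n * n"] unfolding len by (simp add: ac_simps)
    qed
    have init: "init_config M ?x = conf Start (?f, 0) (\<lambda>_. 0, 0) (\<lambda>_. 0, 0) (\<lambda>_. 0, 0)"
      unfolding init_config_def M_def by (simp add: h blank_tape_def input_tape_def numeral_3_eq_3)
    obtain t0 t1 t2 t3 where "runs (4 * (n + 1 + n * n)\<^sup>2) (init_config M ?x)
      (conf (if dec (pair_types (adjacent G) n) then Accept else Reject) t0 t1 t2 t3)"
      unfolding init by (rule run_all)
    then obtain t where t: "t \<le> 4 * (n + 1 + n * n)\<^sup>2" "(tm_step M ^^ t) (init_config M ?x) =
      conf (if dec (pair_types (adjacent G) n) then Accept else Reject) t0 t1 t2 t3"
      unfolding runs_def by blast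
    have "fst ((tm_step M ^^ t) (init_config M ?x)) = (if dec (pair_types (adjacent G) n) then 1 else 2)"
      unfolding t(2) using h by (simp split: if_split)
    moreover have "t \<le> poly (monom 4 2) (length ?x)" "card (verts G) = n"
      using t(1) V(1) unfolding poly_monom len by simp_all
    ultimately show ?thesis
      unfolding accepts_within_def rejects_within_def Let_def
      by (cases "dec (pair_types (adjacent G) n)") (use if_True if_False in \<open>metis\<close>)+
  qed
  then show ?thesis
    unfolding poly_time_solvable_on_def using wf_M by blast
qed

section \<open>Reading the criteria off the pair types\<close>

definition covers :: "entry set \<Rightarrow> bool" where
  "covers S \<longleftrightarrow> (\<forall>(a, b, x, y)\<in>S. a \<or> b \<or> x \<or> y)"

definition diagonal :: "entry set \<Rightarrow> bool" where
  "diagonal S \<longleftrightarrow> (\<exists>(a, b, x, y)\<in>S. x \<and> y)"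

definition joined :: "entry set \<Rightarrow> bool" where
  "joined S \<longleftrightarrow> (\<exists>(a, b, x, y)\<in>S. a \<and> y)"

lemma pair_type_predicates:
  assumes "verts G = {..<n}" "u < n" "v < n"
  shows "covers (pair_type (adjacent G) n u v) \<longleftrightarrow> dominating_pair G u v"
    and "diagonal (pair_type (adjacent G) n u v) \<longleftrightarrow> u = v"
    and "joined (pair_type (adjacent G) n u v) \<longleftrightarrow> adjacent G u v"
  using assms by (auto simp: covers_def diagonal_def joined_def pair_type_def dominating_pair_def)

lemma pair_types_predicates:
  assumes V: "verts G = {..<n}"
  shows "(\<exists>S\<in>pair_types (adjacent G) n. covers S \<and> diagonal S) \<longleftrightarrow> (\<exists>u. universal G u)"
    and "(\<exists>S\<in>pair_types (adjacent G) n. covers S \<and> joined S) \<longleftrightarrow>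
      (\<exists>u v. dominating_pair G u v \<and> adjacent G u v)"
    and "(\<exists>S\<in>pair_types (adjacent G) n. covers S) \<longleftrightarrow> (\<exists>u v. dominating_pair G u v)"
proof -
  have *: "(\<exists>S\<in>pair_types (adjacent G) n. P S) \<longleftrightarrow> (\<exists>u<n. \<exists>v<n. P (pair_type (adjacent G) n u v))" for P
    by (auto simp: pair_types_def)
  have lt: "u < n \<and> v < n" if "dominating_pair G u v" for u v
    using that V by (auto simp: dominating_pair_def)
  have uni: "universal G u \<longleftrightarrow> dominating_pair G u u" for u
    by (auto simp: universal_def dominating_pair_def)
  show "(\<exists>S\<in>pair_types (adjacent G) n. covers S \<and> diagonal S) \<longleftrightarrow> (\<exists>u. universal G u)"
    unfolding * uni by (auto simp: pair_type_predicates[OF V] dest: lt cong: conj_cong)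
  show "(\<exists>S\<in>pair_types (adjacent G) n. covers S \<and> joined S) \<longleftrightarrow>
      (\<exists>u v. dominating_pair G u v \<and> adjacent G u v)"
    unfolding * by (auto simp: pair_type_predicates[OF V] dest: lt cong: conj_cong)
  show "(\<exists>S\<in>pair_types (adjacent G) n. covers S) \<longleftrightarrow> (\<exists>u v. dominating_pair G u v)"
    unfolding * by (auto simp: pair_type_predicates[OF V] dest: lt cong: conj_cong)
qed

text \<open>The same machine works, because it only has to be correct on encodings from the smaller
  class.\<close>

lemma poly_time_solvable_on_mono:
  assumes "poly_time_solvable_on C P"
    and "\<And>G n. simple_graph G \<Longrightarrow> verts G = {..<n} \<Longrightarrow> C' G \<Longrightarrow> C G \<and> (P' G \<longleftrightarrow> P G)"
  shows "poly_time_solvable_on C' P'"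
proof -
  obtain M p where Mp: "wf_tm M"
    "\<And>G. simple_graph G \<and> (\<exists>n. verts G = {..<n}) \<and> C G \<Longrightarrow>
      (let x = encode_graph G; T = poly p (length x)
       in if P G then accepts_within M x T else rejects_within M x T)"
    using assms(1) unfolding poly_time_solvable_on_def by blast
  show ?thesis
    unfolding poly_time_solvable_on_def
  proof (intro exI conjI allI impI)
    show "wf_tm M"
      by fact
    fix G assume G: "simple_graph G \<and> (\<exists>n. verts G = {..<n}) \<and> C' G"
    then have "C G \<and> (P' G \<longleftrightarrow> P G)"
      using assms(2) by blast
    then show "let x = encode_graph G; T = poly p (length x)
      in if P' G then accepts_within M x T else rejects_within M x T"
      using Mp(2)[of G] G by presburger
  qed
qed

theorem theorem8:
  fixes k :: nat
  assumes "k \<in> {1, 2}"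
  shows "poly_time_solvable_on
           (\<lambda>G. connected_graph G \<and> induced_free (path_graph 5) G)
           (edge_contraction_gamma k)"
proof -
  \<comment> \<open>This states both criteria at once; for \<open>k = 2\<close> the second conjunct
    is trivially true.\<close>
  define dec where "dec E \<longleftrightarrow> \<not> (\<exists>S\<in>E. covers S \<and> diagonal S) \<and>
    (k = 2 \<or> (\<exists>S\<in>E. covers S \<and> joined S) \<or> \<not> (\<exists>S\<in>E. covers S))" for E
  show ?thesis
  proof (rule poly_time_solvable_on_mono[OF poly_time_solvable_on_pair_types[of dec]])
    fix G :: "nat graph" and n
    assume G: "simple_graph G" "connected_graph G \<and> induced_free (path_graph 5) G"
      and V: "verts G = {..<n}"
    have "dec (pair_types (adjacent G) n) \<longleftrightarrow> \<not> (\<exists>u. universal G u) \<and>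
      (k = 2 \<or> (\<exists>u v. dominating_pair G u v \<and> adjacent G u v) \<or> \<not> (\<exists>u v. dominating_pair G u v))"
      unfolding dec_def pair_types_predicates[OF V] ..
    also have "\<dots> \<longleftrightarrow> edge_contraction_gamma k G"
      using assms edge_contraction_gamma_1_iff[of G] edge_contraction_gamma_2_iff[of G] G by auto
    finally have "dec (pair_types (adjacent G) (card (verts G))) \<longleftrightarrow> edge_contraction_gamma k G"
      using V by simp
    moreover have "verts G \<noteq> {}"
      using G unfolding connected_graph_def by blast
    ultimately show "verts G \<noteq> {} \<and> (edge_contraction_gamma k G \<longleftrightarrow>
        dec (pair_types (adjacent G) (card (verts G))))"
      by blast
  qed
qed

end
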